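(* Let $H_1,H_2$ be complex Hilbert spaces and let $S,T:H_1\supseteq D\to H_2$ be densely defined closed linear operators with the same domain $D(S)=D(T)$. Write $\check S=(I+S^*S)^{-1}$, $\check T=(I+T^*T)^{-1}$, $\widehat S=(I+SS^* )^{-1}$, $\widehat T=(I+TT^* )^{-1}$. Then: (1) the operators $\widehat T^{1/2}(T-S)\check S^{1/2}$ and $\widehat S^{1/2}(S-T)\check T^{1/2}$ are bounded and $$\theta(S,T)=\max\Big\{\|\widehat T^{1/2}(T-S)\check S^{1/2}\|,\ \|\widehat S^{1/2}(S-T)\check T^{1/2}\|\Big\};$$ (2) if $T-S$ (defined on $D(T)=D(S)$) is bounded, then $\theta(S,T)\leq \|S-T\|$.
   Context: Hilbert spaces are complex and infinite dimensional. For a densely defined closed operator $A$ from $H_1$ to $H_2$, $\check A=(I+A^*A)^{-1}\in\mathcal B(H_1)$ and $\widehat A=(I+AA^* )^{-1}\in\mathcal B(H_2)$ are bounded positive operators, and $\check A^{1/2},\widehat A^{1/2}$ denote their positive square roots. The graph of $A$ is $G(A)=\{(Ax,x):x\in D(A)\}$, a closed subspace of the product Hilbert space. The gap between densely defined closed operators $A,B$ is $\theta(A,B)=\|P_{G(A)}-P_{G(B)}\|$, where $P_M$ denotes the orthogonal projection onto a closed subspace $M$. For bounded $T-S$ defined on the dense domain $D(T)$, $\|T-S\|$ is its operator norm. *)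

theory Defs
  imports "HOL-Analysis.Analysis"
begin

section \<open>Complex inner product spaces and complex Hilbert spaces\<close>

class complex_vector = real_vector +
  fixes scaleC :: "complex \<Rightarrow> 'a \<Rightarrow> 'a" (infixr \<open>*\<^sub>C\<close> 75)
  assumes scaleC_add_right: "a *\<^sub>C (x + y) = a *\<^sub>C x + a *\<^sub>C y"
    and scaleC_add_left: "(a + b) *\<^sub>C x = a *\<^sub>C x + b *\<^sub>C x"
    and scaleC_scaleC: "a *\<^sub>C (b *\<^sub>C x) = (a * b) *\<^sub>C x"
    and scaleC_one: "1 *\<^sub>C x = x"
    and scaleR_scaleC: "scaleR r x = complex_of_real r *\<^sub>C x"

text \<open>Inner product: conjugate-linear in the first, linear in the second argument.\<close>
class complex_inner = complex_vector + real_normed_vector +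
  fixes cinner :: "'a \<Rightarrow> 'a \<Rightarrow> complex"
  assumes cinner_commute: "cinner x y = cnj (cinner y x)"
    and cinner_add_left: "cinner (x + y) z = cinner x z + cinner y z"
    and cinner_scaleC_left: "cinner (r *\<^sub>C x) y = cnj r * cinner x y"
    and cinner_ge_zero: "0 \<le> Re (cinner x x)"
    and cinner_eq_zero_iff: "cinner x x = 0 \<longleftrightarrow> x = 0"
    and norm_eq_sqrt_cinner: "norm x = sqrt (Re (cinner x x))"

class chilbert_space = complex_inner + complete_space

text \<open>Infinite dimensionality: no finite set spans the space (complex span).\<close>
definition infinite_dimensional :: "'a::complex_vector itself \<Rightarrow> bool" where
  "infinite_dimensional _ \<longleftrightarrow>
     (\<forall>B::'a set. finite B \<longrightarrow> module.span ((*\<^sub>C)) B \<noteq> UNIV)"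

section \<open>(Unbounded) linear operators, given by a domain and a function\<close>

definition csubspace :: "'a::complex_vector set \<Rightarrow> bool" where
  "csubspace D \<longleftrightarrow> 0 \<in> D \<and> (\<forall>x\<in>D. \<forall>y\<in>D. x + y \<in> D) \<and> (\<forall>c. \<forall>x\<in>D. c *\<^sub>C x \<in> D)"

definition clinear_on :: "'a::complex_vector set \<Rightarrow> ('a \<Rightarrow> 'b::complex_vector) \<Rightarrow> bool" where
  "clinear_on D A \<longleftrightarrow> csubspace D \<and>
     (\<forall>x\<in>D. \<forall>y\<in>D. A (x + y) = A x + A y) \<and> (\<forall>c. \<forall>x\<in>D. A (c *\<^sub>C x) = c *\<^sub>C A x)"

definition clinear :: "('a::complex_vector \<Rightarrow> 'b::complex_vector) \<Rightarrow> bool" where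
  "clinear A \<longleftrightarrow> clinear_on UNIV A"

definition bounded_clinear :: "('a::complex_inner \<Rightarrow> 'b::complex_inner) \<Rightarrow> bool" where
  "bounded_clinear A \<longleftrightarrow> clinear A \<and> (\<exists>K. \<forall>x. norm (A x) \<le> norm x * K)"

definition densely_defined :: "'a::complex_inner set \<Rightarrow> bool" where
  "densely_defined D \<longleftrightarrow> closure D = UNIV"

text \<open>Graph \<open>G(A) = {(Ax, x) : x \<in> D(A)}\<close>, a subset of \<open>H2 \<times> H1\<close>.\<close>
definition op_graph :: "'a set \<Rightarrow> ('a \<Rightarrow> 'b) \<Rightarrow> ('b \<times> 'a) set" where
  "op_graph D A = {(A x, x) | x. x \<in> D}"

definition closed_op :: "'a::complex_inner set \<Rightarrow> ('a \<Rightarrow> 'b::complex_inner) \<Rightarrow> bool" where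
  "closed_op D A \<longleftrightarrow> closed (op_graph D A)"

text \<open>Adjoint \<open>A^*\<close>: domain and action.\<close>
definition adj_dom :: "'a::complex_inner set \<Rightarrow> ('a \<Rightarrow> 'b::complex_inner) \<Rightarrow> 'b set" where
  "adj_dom D A = {y. \<exists>z. \<forall>x\<in>D. cinner (A x) y = cinner x z}"

definition adj :: "'a::complex_inner set \<Rightarrow> ('a \<Rightarrow> 'b::complex_inner) \<Rightarrow> 'b \<Rightarrow> 'a" where
  "adj D A y = (THE z. \<forall>x\<in>D. cinner (A x) y = cinner x z)"

text \<open>\<open>check A = (I + A^*A)^{-1}\<close>, where \<open>D(A^*A) = {x \<in> D(A). Ax \<in> D(A^* )}\<close>.\<close>
definition check_op :: "'a::complex_inner set \<Rightarrow> ('a \<Rightarrow> 'b::complex_inner) \<Rightarrow> 'a \<Rightarrow> 'a" where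
  "check_op D A y = (THE x. x \<in> D \<and> A x \<in> adj_dom D A \<and> x + adj D A (A x) = y)"

text \<open>\<open>hat A = (I + AA^*)^{-1}\<close>, where \<open>D(AA^*) = {y \<in> D(A^*). A^*y \<in> D(A)}\<close>.\<close>
definition hat_op :: "'a::complex_inner set \<Rightarrow> ('a \<Rightarrow> 'b::complex_inner) \<Rightarrow> 'b \<Rightarrow> 'b" where
  "hat_op D A y = (THE x. x \<in> adj_dom D A \<and> adj D A x \<in> D \<and> x + A (adj D A x) = y)"

definition positive_op :: "('a::complex_inner \<Rightarrow> 'a) \<Rightarrow> bool" where
  "positive_op R \<longleftrightarrow> (\<forall>x. Im (cinner x (R x)) = 0 \<and> 0 \<le> Re (cinner x (R x)))"

text \<open>Positive square root of a bounded positive operator.\<close>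
definition op_sqrt :: "('a::complex_inner \<Rightarrow> 'a) \<Rightarrow> 'a \<Rightarrow> 'a" where
  "op_sqrt B = (THE R. bounded_clinear R \<and> positive_op R \<and> (\<forall>x. R (R x) = B x))"

section \<open>Orthogonal projections onto closed subspaces of \<open>H2 \<times> H1\<close>, and the gap\<close>

definition prod_cinner :: "('b::complex_inner \<times> 'a::complex_inner) \<Rightarrow> ('b \<times> 'a) \<Rightarrow> complex" where
  "prod_cinner u v = cinner (fst u) (fst v) + cinner (snd u) (snd v)"

definition orth_proj :: "('b::complex_inner \<times> 'a::complex_inner) set \<Rightarrow> ('b \<times> 'a) \<Rightarrow> ('b \<times> 'a)" where
  "orth_proj M z = (THE p. p \<in> M \<and> (\<forall>m\<in>M. prod_cinner (z - p) m = 0))"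

text \<open>Gap \<open>\<theta>(A,B) = \<parallel>P_{G(A)} - P_{G(B)}\<parallel>\<close> (operator norm on \<open>H2 \<times> H1\<close>, Hilbert product norm).\<close>
definition gap :: "'a::complex_inner set \<Rightarrow> ('a \<Rightarrow> 'b::complex_inner) \<Rightarrow> 'a set \<Rightarrow> ('a \<Rightarrow> 'b) \<Rightarrow> real" where
  "gap DA A DB B = onorm (\<lambda>z. orth_proj (op_graph DA A) z - orth_proj (op_graph DB B) z)"

section \<open>Boundedness and operator norm of an operator defined on a domain E\<close>

definition bounded_on :: "'a::real_normed_vector set \<Rightarrow> ('a \<Rightarrow> 'b::real_normed_vector) \<Rightarrow> bool" where
  "bounded_on E f \<longleftrightarrow> (\<exists>C. \<forall>x\<in>E. norm (f x) \<le> C * norm x)"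

definition opnorm_on :: "'a::real_normed_vector set \<Rightarrow> ('a \<Rightarrow> 'b::real_normed_vector) \<Rightarrow> real" where
  "opnorm_on E f = Sup ((\<lambda>x. norm (f x) / norm x) ` E)"

end

(* Let R = (I + S^* S)^(-1/2) and Q = (I + T T^* )^(-1/2).  The maps u |-> (S R u, R u) and
   u' |-> (Q u', - T^* Q u') are isometries onto the graph G(S) and onto the orthogonal complement
   of G(T), and in these coordinates the inner product of the two points is -<Q (T - S) R u, u'>.
   Hence the norm of F = Q (T - S) R is exactly the norm of (I - P_T) restricted to G(S).
   Writing P_S - P_T = (I - P_T) P_S - P_T (I - P_S), the two pieces are orthogonal, and the
   second is bounded by the same quantity for the pair (T, S); so the gap is the larger of the
   two norms.  If T - S is bounded, ||F u|| <= ||(T - S) R u|| <= ||T - S|| ||u||, as R and Q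
   are contractions.  The positive square roots themselves are obtained from the binomial series
   of sqrt (1 - t), which converges absolutely at t = 1. *)

theory Submission
  imports Defs
begin

section \<open>Complex inner product spaces\<close>

declare scaleC_one [simp]

lemma scaleC_zero_left [simp]: "0 *\<^sub>C x = (0::'a::complex_vector)"
  using scaleC_add_left [of 0 0 x] by simp

lemma scaleC_zero_right [simp]: "a *\<^sub>C 0 = (0::'a::complex_vector)"
  using scaleC_add_right [of a 0 0] by simp

lemma scaleC_minus_left: "(- a) *\<^sub>C x = - (a *\<^sub>C x :: 'a::complex_vector)"
  using scaleC_add_left [of "- a" a x] by (simp add: eq_neg_iff_add_eq_0)

lemma scaleC_minus_right: "a *\<^sub>C (- x) = - (a *\<^sub>C x :: 'a::complex_vector)"
  using scaleC_add_right [of a "- x" x] by (simp add: eq_neg_iff_add_eq_0)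

lemma scaleC_diff_right: "a *\<^sub>C (x - y) = a *\<^sub>C x - a *\<^sub>C (y::'a::complex_vector)"
  by (simp only: diff_conv_add_uminus scaleC_add_right scaleC_minus_right)

lemma minus_eq_scaleC: "- x = (- 1) *\<^sub>C (x::'a::complex_vector)"
  by (simp add: scaleC_minus_left)

lemma scaleR_scaleC_commute: "r *\<^sub>R (a *\<^sub>C x) = a *\<^sub>C (r *\<^sub>R x :: 'a::complex_vector)"
  by (simp add: scaleR_scaleC scaleC_scaleC mult.commute)

lemma cinner_add_right: "cinner x (y + z :: 'a::complex_inner) = cinner x y + cinner x z"
  by (simp only: cinner_commute [of x] cinner_add_left complex_cnj_add)

lemma cinner_scaleC_right: "cinner x (c *\<^sub>C y) = c * cinner x (y::'a::complex_inner)"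
  by (simp only: cinner_commute [of x] cinner_scaleC_left complex_cnj_cnj complex_cnj_mult)

lemma cinner_zero_left [simp]: "cinner 0 (x::'a::complex_inner) = 0"
  using cinner_add_left [of 0 0 x] by simp

lemma cinner_zero_right [simp]: "cinner (x::'a::complex_inner) 0 = 0"
  using cinner_add_right [of x 0 0] by simp

lemma cinner_minus_left: "cinner (- x) y = - cinner x (y::'a::complex_inner)"
  using cinner_add_left [of "- x" x y] by (simp add: eq_neg_iff_add_eq_0)

lemma cinner_minus_right: "cinner x (- y) = - cinner x (y::'a::complex_inner)"
  using cinner_add_right [of x "- y" y] by (simp add: eq_neg_iff_add_eq_0)

lemma cinner_diff_left: "cinner (x - y) z = cinner x z - cinner y (z::'a::complex_inner)"
  using cinner_add_left [of x "- y" z] by (simp add: cinner_minus_left)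

lemma cinner_diff_right: "cinner x (y - z) = cinner x y - cinner x (z::'a::complex_inner)"
  using cinner_add_right [of x y "- z"] by (simp add: cinner_minus_right)

lemma cinner_scaleR_left: "cinner (r *\<^sub>R x) y = of_real r * cinner x (y::'a::complex_inner)"
  by (simp add: scaleR_scaleC cinner_scaleC_left)

lemma cinner_scaleR_right: "cinner x (r *\<^sub>R y) = of_real r * cinner x (y::'a::complex_inner)"
  by (simp add: scaleR_scaleC cinner_scaleC_right)

lemma cinner_self: "cinner x x = of_real ((norm (x::'a::complex_inner))\<^sup>2)"
proof -
  have "Im (cinner x x) = 0"
    using arg_cong [OF cinner_commute [of x x], of Im] by simp
  then show ?thesis
    using cinner_ge_zero [of x] by (simp add: norm_eq_sqrt_cinner complex_eq_iff)
qed

lemma Re_cinner_self: "Re (cinner x x) = (norm (x::'a::complex_inner))\<^sup>2"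
  by (simp add: cinner_self)

lemma Re_cinner_commute: "Re (cinner x y) = Re (cinner y (x::'a::complex_inner))"
  by (subst cinner_commute) simp

lemma norm_add_sq: "(norm (x + y))\<^sup>2 = (norm x)\<^sup>2 + (norm y)\<^sup>2 + 2 * Re (cinner x (y::'a::complex_inner))"
  using Re_cinner_commute
  by (simp flip: Re_cinner_self add: cinner_add_left cinner_add_right)

lemma norm_diff_sq: "(norm (x - y))\<^sup>2 = (norm x)\<^sup>2 + (norm y)\<^sup>2 - 2 * Re (cinner x (y::'a::complex_inner))"
  using Re_cinner_commute
  by (simp flip: Re_cinner_self add: cinner_diff_left cinner_diff_right)

lemma norm_scaleC: "norm (c *\<^sub>C x) = cmod c * norm (x::'a::complex_inner)"
proof -
  have "cinner (c *\<^sub>C x) (c *\<^sub>C x) = of_real ((cmod c)\<^sup>2) * cinner x x"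
    by (simp add: cinner_scaleC_left cinner_scaleC_right mult.assoc flip: complex_norm_square)
  then have "(norm (c *\<^sub>C x))\<^sup>2 = (cmod c * norm x)\<^sup>2"
    by (simp flip: Re_cinner_self add: power_mult_distrib)
  then show ?thesis
    by simp
qed

lemma Re_cinner_le: "Re (cinner x y) \<le> norm x * norm (y::'a::complex_inner)"
proof -
  let ?a = "norm x" and ?b = "norm y"
  have "(norm (?b *\<^sub>R x - ?a *\<^sub>R y))\<^sup>2
      = (norm (?b *\<^sub>R x))\<^sup>2 + (norm (?a *\<^sub>R y))\<^sup>2 - 2 * Re (cinner (?b *\<^sub>R x) (?a *\<^sub>R y))"
    by (rule norm_diff_sq)
  also have "\<dots> = 2 * (?a * ?b) * (?a * ?b) - 2 * (?a * ?b) * Re (cinner x y)"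
    by (simp add: cinner_scaleR_left cinner_scaleR_right power2_eq_square)
  finally have "0 \<le> 2 * (?a * ?b) * (?a * ?b) - 2 * (?a * ?b) * Re (cinner x y)"
    by (metis zero_le_power2)
  then have "(?a * ?b) * Re (cinner x y) \<le> (?a * ?b) * (?a * ?b)"
    by simp
  then show ?thesis
    by (cases "?a * ?b = 0") (auto simp: mult_le_cancel_left_pos)
qed

text \<open>Cauchy--Schwarz: rotate \<open>x\<close> so that the inner product becomes real.\<close>

lemma norm_cinner_le: "cmod (cinner x y) \<le> norm x * norm (y::'a::complex_inner)"
proof -
  let ?c = "cinner x y"
  have "Re (cinner (?c *\<^sub>C x) y) = Re (?c * cnj ?c)"
    by (simp add: cinner_scaleC_left mult.commute)
  also have "\<dots> = (cmod ?c)\<^sup>2"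
    by (simp flip: complex_norm_square)
  finally have "Re (cinner (?c *\<^sub>C x) y) = (cmod ?c)\<^sup>2" .
  with Re_cinner_le [of "?c *\<^sub>C x" y] have "cmod ?c * cmod ?c \<le> cmod ?c * (norm x * norm y)"
    by (simp add: norm_scaleC power2_eq_square mult.assoc)
  then show ?thesis
    by (cases "?c = 0") auto
qed

lemma norm_add_sq_orthogonal: "cinner x (y::'a::complex_inner) = 0 \<Longrightarrow> (norm (x + y))\<^sup>2 = (norm x)\<^sup>2 + (norm y)\<^sup>2"
  by (simp add: norm_add_sq)

lemma norm_diff_sq_orthogonal: "cinner x (y::'a::complex_inner) = 0 \<Longrightarrow> (norm (x - y))\<^sup>2 = (norm x)\<^sup>2 + (norm y)\<^sup>2"
  by (simp add: norm_diff_sq)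

lemma eq_0_if_orthogonal_all: "(\<And>y. cinner y x = 0) \<Longrightarrow> (x::'a::complex_inner) = 0"
  using cinner_eq_zero_iff by blast

lemma eq_0_if_add_eq_0_cinner_self:
  fixes x y :: "'a::complex_inner" and z :: "'b::complex_inner"
  assumes "x + y = 0" and "cinner x y = cinner z z"
  shows "x = 0"
proof -
  have "cinner x x + cinner z z = 0"
    using arg_cong [OF assms(1), of "cinner x"] assms(2) by (simp add: cinner_add_right)
  then have "(norm x)\<^sup>2 + (norm z)\<^sup>2 = 0"
    by (metis cinner_self of_real_add of_real_eq_0_iff)
  then show ?thesis
    by (simp add: add_nonneg_eq_0_iff)
qed

lemma bounded_bilinear_cinner: "bounded_bilinear (cinner :: 'a::complex_inner \<Rightarrow> 'a \<Rightarrow> complex)"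
proof
  fix a a' b b' :: 'a and r :: real
  show "cinner (a + a') b = cinner a b + cinner a' b"
    by (rule cinner_add_left)
  show "cinner a (b + b') = cinner a b + cinner a b'"
    by (rule cinner_add_right)
  show "cinner (r *\<^sub>R a) b = r *\<^sub>R cinner a b" "cinner a (r *\<^sub>R b) = r *\<^sub>R cinner a b"
    by (simp_all add: cinner_scaleR_left cinner_scaleR_right scaleR_conv_of_real)
  show "\<exists>K. \<forall>a b. norm (cinner (a::'a) b) \<le> norm a * norm b * K"
    by (intro exI [of _ 1]) (simp add: norm_cinner_le)
qed

lemmas tendsto_cinner = bounded_bilinear.tendsto [OF bounded_bilinear_cinner]
lemmas bounded_linear_cinner_left = bounded_bilinear.bounded_linear_left [OF bounded_bilinear_cinner]
lemmas bounded_linear_cinner_right = bounded_bilinear.bounded_linear_right [OF bounded_bilinear_cinner]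

lemma bounded_linear_scaleC: "bounded_linear (\<lambda>x::'a::complex_inner. c *\<^sub>C x)"
proof
  show "\<exists>K. \<forall>x::'a. norm (c *\<^sub>C x) \<le> norm x * K"
    by (rule exI [of _ "cmod c"]) (simp add: norm_scaleC mult.commute)
qed (simp_all add: scaleC_add_right scaleR_scaleC_commute)

lemmas tendsto_scaleC = bounded_linear.tendsto [OF bounded_linear_scaleC]

instantiation prod :: (complex_vector, complex_vector) complex_vector
begin

definition scaleC_prod_def: "c *\<^sub>C p = (c *\<^sub>C fst p, c *\<^sub>C snd p)"

instance
  by standard (auto simp: scaleC_prod_def scaleC_add_right scaleC_add_left scaleC_scaleC
      prod_eq_iff scaleR_scaleC [symmetric])

end

lemma scaleC_Pair [simp]: "c *\<^sub>C (a, b) = (c *\<^sub>C a, c *\<^sub>C b)"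
  by (simp add: scaleC_prod_def)

instantiation prod :: (complex_inner, complex_inner) complex_inner
begin

definition cinner_prod_def: "cinner p q = cinner (fst p) (fst q) + cinner (snd p) (snd q)"

instance
proof
  fix x y z :: "'a \<times> 'b" and r :: complex
  show "cinner x y = cnj (cinner y x)"
    unfolding cinner_prod_def by (subst (1 2) cinner_commute) simp
  show "cinner (x + y) z = cinner x z + cinner y z"
    unfolding cinner_prod_def by (simp add: cinner_add_left)
  show "cinner (r *\<^sub>C x) y = cnj r * cinner x y"
    unfolding cinner_prod_def by (simp add: scaleC_prod_def cinner_scaleC_left distrib_left)
  show "0 \<le> Re (cinner x x)" "norm x = sqrt (Re (cinner x x))"
    unfolding cinner_prod_def norm_prod_def by (simp_all add: Re_cinner_self)
  show "cinner x x = 0 \<longleftrightarrow> x = 0"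
  proof
    assume "cinner x x = 0"
    then have "complex_of_real ((norm (fst x))\<^sup>2 + (norm (snd x))\<^sup>2) = 0"
      unfolding cinner_prod_def by (simp only: cinner_self of_real_add)
    then have "(norm (fst x))\<^sup>2 + (norm (snd x))\<^sup>2 = 0"
      by (simp only: of_real_eq_0_iff)
    then show "x = 0"
      by (simp add: prod_eq_iff add_nonneg_eq_0_iff)
  qed (simp add: cinner_prod_def)
qed

end

instance prod :: (chilbert_space, chilbert_space) chilbert_space ..

subclass (in chilbert_space) banach ..

lemma cinner_Pair: "cinner (a, b) (c, d) = cinner a c + cinner b d"
  by (simp add: cinner_prod_def)

lemma norm_Pair_sq: "(norm (a, b))\<^sup>2 = (norm a)\<^sup>2 + (norm b)\<^sup>2"
  by (simp add: norm_prod_def)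

section \<open>Closed subspaces and orthogonal projections\<close>

lemma csubspace_0: "csubspace M \<Longrightarrow> 0 \<in> M"
  and csubspace_add: "csubspace M \<Longrightarrow> x \<in> M \<Longrightarrow> y \<in> M \<Longrightarrow> x + y \<in> M"
  and csubspace_scaleC: "csubspace M \<Longrightarrow> x \<in> M \<Longrightarrow> c *\<^sub>C x \<in> M"
  by (simp_all add: csubspace_def)

lemma csubspace_diff: "csubspace M \<Longrightarrow> x \<in> M \<Longrightarrow> y \<in> M \<Longrightarrow> x - y \<in> M"
  using csubspace_add [of M x "(- 1) *\<^sub>C y"] csubspace_scaleC [of M y "- 1"]
  by (simp flip: minus_eq_scaleC)

lemma csubspace_scaleR: "csubspace M \<Longrightarrow> x \<in> M \<Longrightarrow> r *\<^sub>R x \<in> M"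
  by (simp add: scaleR_scaleC csubspace_scaleC)

lemma csubspace_UNIV: "csubspace UNIV"
  by (simp add: csubspace_def)

lemma csubspace_range:
  fixes f :: "'a::complex_vector \<Rightarrow> 'b::complex_vector"
  assumes add: "\<And>x y. f (x + y) = f x + f y" and scaleC: "\<And>c x. f (c *\<^sub>C x) = c *\<^sub>C f x"
  shows "csubspace (range f)"
  unfolding csubspace_def
proof (intro conjI ballI allI)
  have "f 0 = 0"
    using scaleC [of 0 0] by simp
  then show "0 \<in> range f"
    by (metis rangeI)
  show "x + y \<in> range f" if "x \<in> range f" "y \<in> range f" for x y
    using that by (auto simp flip: add)
  show "c *\<^sub>C x \<in> range f" if "x \<in> range f" for c x
    using that by (auto simp flip: scaleC)
qed

lemma csubspace_closure:
  fixes M :: "'a::complex_inner set"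
  assumes "csubspace M"
  shows "csubspace (closure M)"
  unfolding csubspace_def
proof (intro conjI ballI allI)
  show "0 \<in> closure M"
    using csubspace_0 [OF assms] closure_subset by blast
next
  fix x y assume "x \<in> closure M" "y \<in> closure M"
  then obtain f g where "\<forall>n. f n \<in> M" "f \<longlonglongrightarrow> x" "\<forall>n. g n \<in> M" "g \<longlonglongrightarrow> y"
    by (meson closure_sequential)
  then have "\<forall>n. f n + g n \<in> M" "(\<lambda>n. f n + g n) \<longlonglongrightarrow> x + y"
    using csubspace_add [OF assms] by (auto intro: tendsto_add)
  then show "x + y \<in> closure M"
    by (meson closure_sequential)
next
  fix c x assume "x \<in> closure M"
  then obtain f where "\<forall>n. f n \<in> M" "f \<longlonglongrightarrow> x"
    by (meson closure_sequential)
  then have "\<forall>n. c *\<^sub>C f n \<in> M" "(\<lambda>n. c *\<^sub>C f n) \<longlonglongrightarrow> c *\<^sub>C x"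
    using csubspace_scaleC [OF assms] by (auto intro: tendsto_scaleC)
  then show "c *\<^sub>C x \<in> closure M"
    by (meson closure_sequential)
qed

lemma csubspace_op_graph: "clinear_on D A \<Longrightarrow> csubspace (op_graph D A)"
  unfolding clinear_on_def csubspace_def op_graph_def zero_prod_def
  by (auto simp: scaleC_prod_def) (metis scaleC_zero_left)

lemma parallelogram_law:
  fixes a b :: "'a::complex_inner"
  shows "(norm (a - b))\<^sup>2 + (norm (a + b))\<^sup>2 = 2 * (norm a)\<^sup>2 + 2 * (norm b)\<^sup>2"
  by (simp add: norm_add_sq norm_diff_sq)

text \<open>The midpoint of two almost minimising points is a competitor; the parallelogram law then
  forces the two points to be close.\<close>

lemma Cauchy_minimizing_sequence:
  fixes f :: "nat \<Rightarrow> 'a::complex_inner"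
  assumes M: "csubspace M" and d: "0 \<le> d" "\<And>m. m \<in> M \<Longrightarrow> d \<le> norm (z - m)"
    and f: "\<And>n. f n \<in> M" "\<And>n. (norm (z - f n))\<^sup>2 < d\<^sup>2 + 1 / real (Suc n)"
  shows "Cauchy f"
proof (rule CauchyI)
  have close: "(norm (f k - f n))\<^sup>2 < 2 / real (Suc n) + 2 / real (Suc k)" for n k
  proof -
    let ?a = "z - f n" and ?b = "z - f k"
    have "(1/2::real) *\<^sub>R (f n + f k) \<in> M"
      using f(1) M by (intro csubspace_scaleR csubspace_add)
    moreover have "?a + ?b = 2 *\<^sub>R (z - (1/2::real) *\<^sub>R (f n + f k))"
      by (simp add: algebra_simps scaleR_2)
    ultimately have "2 * d \<le> norm (?a + ?b)"
      using d(2) by simp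
    then have "(2 * d)\<^sup>2 \<le> (norm (?a + ?b))\<^sup>2"
      using d(1) by (intro power_mono) auto
    moreover note parallelogram_law [of ?a ?b]
    ultimately show ?thesis
      using f(2) [of n] f(2) [of k] by (simp add: power_mult_distrib norm_minus_commute)
  qed
  fix e :: real assume "0 < e"
  obtain N :: nat where "4 / e\<^sup>2 < real (Suc N)"
    using reals_Archimedean2 by (metis less_Suc_eq of_nat_less_iff order_less_trans)
  then have N: "4 / real (Suc N) < e\<^sup>2"
    using \<open>0 < e\<close> by (simp add: field_simps)
  show "\<exists>M. \<forall>m\<ge>M. \<forall>n\<ge>M. norm (f m - f n) < e"
  proof (intro exI allI impI)
    fix m n assume "N \<le> m" "N \<le> n"
    then have "2 / real (Suc n) + 2 / real (Suc m) \<le> 4 / real (Suc N)"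
      using add_mono [OF divide_left_mono divide_left_mono, of "real (Suc N)" "real (Suc n)" 2
          "real (Suc N)" "real (Suc m)" 2] by simp
    then have "(norm (f m - f n))\<^sup>2 < e\<^sup>2"
      using close [of m n] N by linarith
    then show "norm (f m - f n) < e"
      using \<open>0 < e\<close> by (simp add: power_less_imp_less_base)
  qed
qed

lemma nearest_point_exists:
  fixes M :: "'a::chilbert_space set"
  assumes M: "csubspace M" "closed M"
  shows "\<exists>p\<in>M. \<forall>m\<in>M. norm (z - p) \<le> norm (z - m)"
proof -
  let ?S = "(\<lambda>m. norm (z - m)) ` M"
  define d where "d = Inf ?S"
  have ne: "?S \<noteq> {}" and bdd: "bdd_below ?S"
    using csubspace_0 [OF M(1)] by (auto intro: bdd_belowI [of _ 0])
  have d_le: "d \<le> norm (z - m)" if "m \<in> M" for m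
    unfolding d_def using bdd that by (intro cInf_lower) auto
  have d0: "0 \<le> d"
    unfolding d_def using ne by (intro cInf_greatest) auto
  have "\<exists>m\<in>M. (norm (z - m))\<^sup>2 < d\<^sup>2 + 1 / real (Suc n)" for n
  proof -
    let ?e = "sqrt (d\<^sup>2 + 1 / real (Suc n))"
    have "Inf ?S < ?e"
      using d0 real_sqrt_less_mono [of "d\<^sup>2" "d\<^sup>2 + 1 / real (Suc n)"] by (simp add: d_def [symmetric])
    then obtain m where "m \<in> M" "norm (z - m) < ?e"
      using cInf_less_iff [OF ne bdd] by auto
    then show ?thesis
      by (metis norm_ge_zero power_strict_mono real_sqrt_pow2 zero_less_numeral
          add_nonneg_nonneg zero_le_power2 divide_nonneg_nonneg zero_le_one of_nat_0_le_iff)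
  qed
  then obtain f where f: "\<And>n. f n \<in> M" "\<And>n. (norm (z - f n))\<^sup>2 < d\<^sup>2 + 1 / real (Suc n)"
    by metis
  obtain p where p: "f \<longlonglongrightarrow> p"
    using Cauchy_minimizing_sequence [OF M(1) d0 d_le f] Cauchy_convergent_iff convergent_def by blast
  have "norm (z - p) \<le> norm (z - m)" if "m \<in> M" for m
  proof (rule LIMSEQ_le)
    show "(\<lambda>n. sqrt ((norm (z - f n))\<^sup>2)) \<longlonglongrightarrow> norm (z - p)"
      using p by (simp add: tendsto_intros)
    show "(\<lambda>n. sqrt ((norm (z - m))\<^sup>2 + 1 / real (Suc n))) \<longlonglongrightarrow> norm (z - m)"
      using tendsto_add [OF tendsto_const LIMSEQ_inverse_real_of_nat, of "(norm (z - m))\<^sup>2"]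
      by (auto intro: tendsto_eq_intros simp: inverse_eq_divide)
    show "\<exists>N. \<forall>n\<ge>N. sqrt ((norm (z - f n))\<^sup>2) \<le> sqrt ((norm (z - m))\<^sup>2 + 1 / real (Suc n))"
      using f(2) d_le [OF that] d0 power_mono [OF d_le [OF that] d0, of 2]
      by (intro exI [of _ 0] allI impI real_sqrt_le_mono) (smt (verit))
  qed
  moreover have "p \<in> M"
    using M(2) f(1) p closed_sequentially by blast
  ultimately show ?thesis
    by blast
qed

text \<open>Moving \<open>p\<close> by a small multiple of \<open>\<langle>z - p, m\<rangle> m\<close> would decrease the distance to \<open>z\<close>
  at second order.\<close>

lemma nearest_point_orthogonal:
  fixes M :: "'a::complex_inner set"
  assumes M: "csubspace M" and p: "p \<in> M" "\<forall>m'\<in>M. norm (z - p) \<le> norm (z - m')" and m: "m \<in> M"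
  shows "cinner (z - p) m = 0"
proof -
  let ?w = "z - p" and ?a = "cinner (z - p) m"
  define t where "t = 1 / ((norm m)\<^sup>2 + 1)"
  have "0 < (norm m)\<^sup>2 + 1"
    by (simp add: add_nonneg_pos)
  then have t: "0 < t" "t * (norm m)\<^sup>2 \<le> 1"
    unfolding t_def by (simp_all add: field_simps)
  let ?v = "t *\<^sub>R (cnj ?a *\<^sub>C m)"
  have "p + ?v \<in> M"
    using p m M by (intro csubspace_add csubspace_scaleR csubspace_scaleC)
  then have "(norm ?w)\<^sup>2 \<le> (norm (?w - ?v))\<^sup>2"
    using p(2) by (simp add: algebra_simps)
  also have "cinner ?w ?v = of_real (t * (cmod ?a)\<^sup>2)"
    by (simp add: cinner_scaleR_right cinner_scaleC_right mult.commute flip: complex_norm_square)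
  then have "(norm (?w - ?v))\<^sup>2 = (norm ?w)\<^sup>2 + (t * (cmod ?a * norm m))\<^sup>2 - 2 * (t * (cmod ?a)\<^sup>2)"
    using t(1) by (simp add: norm_diff_sq norm_scaleC)
  finally have "2 * t * (cmod ?a)\<^sup>2 \<le> t * ((cmod ?a)\<^sup>2 * (t * (norm m)\<^sup>2))"
    by (simp add: power_mult_distrib power2_eq_square algebra_simps)
  also have "\<dots> \<le> t * (cmod ?a)\<^sup>2"
    using t by (simp add: mult_left_le)
  finally show ?thesis
    using t(1) by simp
qed

definition proj :: "'a::complex_inner set \<Rightarrow> 'a \<Rightarrow> 'a" where
  "proj M z = (THE p. p \<in> M \<and> (\<forall>m\<in>M. cinner (z - p) m = 0))"

lemma proj_unique:
  fixes M :: "'a::complex_inner set"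
  assumes M: "csubspace M"
    and "p \<in> M" "\<forall>m\<in>M. cinner (z - p) m = 0" and "q \<in> M" "\<forall>m\<in>M. cinner (z - q) m = 0"
  shows "p = q"
proof -
  have "p - q \<in> M"
    using assms by (intro csubspace_diff)
  then have "cinner (p - q) (p - q) = 0"
    using assms by (simp add: cinner_diff_left)
  then show ?thesis
    by (simp add: cinner_eq_zero_iff)
qed

lemma
  fixes M :: "'a::chilbert_space set"
  assumes "csubspace M" "closed M"
  shows proj_in: "proj M z \<in> M"
    and proj_orthogonal: "\<forall>m\<in>M. cinner (z - proj M z) m = 0"
proof -
  have "\<exists>!p. p \<in> M \<and> (\<forall>m\<in>M. cinner (z - p) m = 0)"
    using nearest_point_exists [OF assms] nearest_point_orthogonal [OF assms(1)] proj_unique [OF assms(1)]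
    by metis
  then have "proj M z \<in> M \<and> (\<forall>m\<in>M. cinner (z - proj M z) m = 0)"
    unfolding proj_def by (rule theI')
  then show "proj M z \<in> M" "\<forall>m\<in>M. cinner (z - proj M z) m = 0"
    by auto
qed

lemma proj_eqI:
  fixes M :: "'a::chilbert_space set"
  assumes "csubspace M" "closed M" "p \<in> M" "\<forall>m\<in>M. cinner (z - p) m = 0"
  shows "proj M z = p"
  using proj_unique [OF assms(1) proj_in proj_orthogonal] assms by blast

lemma proj_id:
  fixes M :: "'a::chilbert_space set"
  shows "csubspace M \<Longrightarrow> closed M \<Longrightarrow> z \<in> M \<Longrightarrow> proj M z = z"
  by (intro proj_eqI) auto

lemma orthogonal_proj:
  fixes M :: "'a::chilbert_space set"
  assumes "csubspace M" "closed M" "m \<in> M"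
  shows "cinner m (z - proj M z) = 0"
  using proj_orthogonal [OF assms(1,2)] assms(3) by (metis cinner_commute complex_cnj_zero)

lemma norm_proj_sq:
  fixes M :: "'a::chilbert_space set"
  assumes "csubspace M" "closed M"
  shows "(norm z)\<^sup>2 = (norm (proj M z))\<^sup>2 + (norm (z - proj M z))\<^sup>2"
proof -
  have "cinner (proj M z) (z - proj M z) = 0"
    by (rule orthogonal_proj [OF assms proj_in [OF assms]])
  then show ?thesis
    using norm_add_sq_orthogonal by fastforce
qed

lemma norm_proj_le:
  fixes M :: "'a::chilbert_space set"
  shows "csubspace M \<Longrightarrow> closed M \<Longrightarrow> norm (proj M z) \<le> norm z"
  using norm_proj_sq by (metis le_add_same_cancel1 norm_ge_zero power2_le_imp_le zero_le_power2)

lemma norm_diff_proj_le: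
  fixes M :: "'a::chilbert_space set"
  shows "csubspace M \<Longrightarrow> closed M \<Longrightarrow> norm (z - proj M z) \<le> norm z"
  using norm_proj_sq by (metis le_add_same_cancel2 norm_ge_zero power2_le_imp_le zero_le_power2)

lemma bounded_linear_proj:
  fixes M :: "'a::chilbert_space set"
  assumes M: "csubspace M" "closed M"
  shows "bounded_linear (proj M)"
proof
  fix x y :: 'a and r :: real
  note P = proj_in [OF M] proj_orthogonal [OF M]
  show "proj M (x + y) = proj M x + proj M y"
  proof (rule proj_eqI [OF M])
    show "proj M x + proj M y \<in> M"
      using P M by (intro csubspace_add) auto
    show "\<forall>m\<in>M. cinner (x + y - (proj M x + proj M y)) m = 0"
      using P(2) [of x] P(2) [of y] by (simp add: cinner_diff_left cinner_add_left algebra_simps)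
  qed
  show "proj M (r *\<^sub>R x) = r *\<^sub>R proj M x"
  proof (rule proj_eqI [OF M])
    show "r *\<^sub>R proj M x \<in> M"
      using P M by (intro csubspace_scaleR) auto
    show "\<forall>m\<in>M. cinner (r *\<^sub>R x - r *\<^sub>R proj M x) m = 0"
      using P(2) [of x] by (simp add: cinner_scaleR_left flip: scaleR_diff_right)
  qed
  show "\<exists>K. \<forall>x. norm (proj M x) \<le> norm x * K"
    using norm_proj_le [OF M] by (intro exI [of _ 1]) simp
qed

lemma closure_dense_csubspace:
  fixes M N :: "'a::chilbert_space set"
  assumes "csubspace M" "M \<subseteq> N" "csubspace N" "closed N"
    and orth: "\<And>v. v \<in> N \<Longrightarrow> \<forall>m\<in>M. cinner m v = 0 \<Longrightarrow> v = 0"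
  shows "N \<subseteq> closure M"
proof
  fix v assume "v \<in> N"
  let ?C = "closure M"
  have C: "csubspace ?C" "closed ?C"
    using csubspace_closure [OF assms(1)] by simp_all
  have "?C \<subseteq> N"
    using assms(2,4) by (rule closure_minimal)
  then have "v - proj ?C v \<in> N"
    using \<open>v \<in> N\<close> proj_in [OF C] assms(3) by (blast intro: csubspace_diff)
  moreover have "\<forall>m\<in>M. cinner m (v - proj ?C v) = 0"
    using orthogonal_proj [OF C] closure_subset by blast
  ultimately have "v - proj ?C v = 0"
    by (rule orth)
  then show "v \<in> ?C"
    using proj_in [OF C, of v] by simp
qed

section \<open>The binomial series of \<open>sqrt (1 - t)\<close>\<close>

text \<open>The coefficients are determined by requiring that the Cauchy square of the series is \<open>1 - t\<close>.\<close>

fun sqrt_coeff :: "nat \<Rightarrow> real" where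
  "sqrt_coeff n =
    (if n = 0 then 1
     else ((if n = 1 then -1 else 0) - (\<Sum>i\<in>{1..<n}. sqrt_coeff i * sqrt_coeff (n - i))) / 2)"

declare sqrt_coeff.simps [simp del]

lemma sqrt_coeff_0 [simp]: "sqrt_coeff 0 = 1"
  by (simp add: sqrt_coeff.simps)

lemma sqrt_coeff_rec:
  "n \<noteq> 0 \<Longrightarrow>
    2 * sqrt_coeff n = (if n = 1 then -1 else 0) - (\<Sum>i\<in>{1..<n}. sqrt_coeff i * sqrt_coeff (n - i))"
  by (subst sqrt_coeff.simps) simp

lemma sqrt_coeff_convolution:
  "(\<Sum>i\<le>n. sqrt_coeff i * sqrt_coeff (n - i)) = (if n = 0 then 1 else if n = 1 then -1 else 0)"
proof (cases "n = 0")
  case False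
  then have "{..n} = insert 0 (insert n {1..<n})"
    by auto
  with False sqrt_coeff_rec [OF False] show ?thesis
    by simp
qed simp

lemma sqrt_coeff_nonpos: "1 \<le> n \<Longrightarrow> sqrt_coeff n \<le> 0"
proof (induction n rule: less_induct)
  case (less n)
  have "0 \<le> (\<Sum>i\<in>{1..<n}. sqrt_coeff i * sqrt_coeff (n - i))"
    using less.IH by (intro sum_nonneg mult_nonpos_nonpos) auto
  with less.prems show ?case
    by (subst sqrt_coeff.simps) simp
qed

lemma sum_sqrt_coeff_convolution_le:
  "(\<Sum>n\<in>{1..N}. \<Sum>i\<in>{1..<n}. sqrt_coeff i * sqrt_coeff (n - i)) \<le> (\<Sum>i\<in>{1..<N}. - sqrt_coeff i)\<^sup>2"
proof -
  let ?c = sqrt_coeff and ?T = "SIGMA n:{1..N}. {1..<n}" and ?g = "\<lambda>(n, i). (i, n - i)"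
  have "(\<Sum>n\<in>{1..N}. \<Sum>i\<in>{1..<n}. ?c i * ?c (n - i)) = (\<Sum>(i, j)\<in>?g ` ?T. ?c i * ?c j)"
    by (subst sum.reindex) (auto simp: inj_on_def sum.Sigma intro!: sum.cong)
  also have "\<dots> \<le> (\<Sum>(i, j)\<in>{1..<N} \<times> {1..<N}. ?c i * ?c j)"
    using sqrt_coeff_nonpos by (intro sum_mono2) (auto intro!: mult_nonpos_nonpos)
  also have "\<dots> = (\<Sum>i\<in>{1..<N}. - ?c i)\<^sup>2"
    by (simp add: power2_eq_square sum_product sum.cartesian_product)
  finally show ?thesis .
qed

lemma sum_sqrt_coeff_le: "(\<Sum>i\<in>{1..N}. - sqrt_coeff i) \<le> 1"
proof (induction N rule: less_induct)
  case (less N)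
  show ?case
  proof (cases "N = 0")
    case False
    let ?c = sqrt_coeff and ?s = "\<Sum>i\<in>{1..<N}. - sqrt_coeff i"
    have s: "0 \<le> ?s" "?s \<le> 1"
      using sqrt_coeff_nonpos less.IH [of "N - 1"] False
      by (auto intro: sum_nonneg simp: atLeastLessThan_nat_numeral atLeastLessThanSuc_atLeastAtMost
          simp flip: atLeastLessThanSuc_atLeastAtMost)
    have "{1..N} = insert 1 {2..N}"
      using False by auto
    then have "2 * (\<Sum>i\<in>{1..N}. - ?c i) = 1 + (\<Sum>n\<in>{1..N}. \<Sum>i\<in>{1..<n}. ?c i * ?c (n - i))"
      by (simp add: sum_distrib_left sqrt_coeff_rec sum.distrib sum_negf)
    also have "\<dots> \<le> 1 + ?s\<^sup>2"
      using sum_sqrt_coeff_convolution_le by simp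
    also have "\<dots> \<le> 2"
      using s by (simp add: power_le_one)
    finally show ?thesis
      by simp
  qed simp
qed

lemma summable_abs_sqrt_coeff: "summable (\<lambda>n. \<bar>sqrt_coeff n\<bar>)"
proof (rule bounded_imp_summable)
  fix n :: nat
  have "{..n} = insert 0 {1..n}"
    by auto
  then have "(\<Sum>k\<le>n. \<bar>sqrt_coeff k\<bar>) = 1 + (\<Sum>k\<in>{1..n}. - sqrt_coeff k)"
    using sqrt_coeff_nonpos by (simp add: abs_of_nonpos)
  then show "(\<Sum>k\<le>n. \<bar>sqrt_coeff k\<bar>) \<le> 2"
    using sum_sqrt_coeff_le [of n] by simp
qed simp

lemma summable_sqrt_coeff: "summable sqrt_coeff"
  using summable_abs_sqrt_coeff by (rule summable_rabs_cancel)

lemma suminf_sqrt_coeff_nonneg: "0 \<le> suminf sqrt_coeff"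
proof (rule LIMSEQ_le_const)
  show "(\<lambda>n. \<Sum>k\<le>n. sqrt_coeff k) \<longlonglongrightarrow> suminf sqrt_coeff"
    using summable_LIMSEQ' [OF summable_sqrt_coeff] .
  show "\<exists>N. \<forall>n\<ge>N. 0 \<le> (\<Sum>k\<le>n. sqrt_coeff k)"
  proof (intro exI allI impI)
    fix n :: nat
    have "{..n} = insert 0 {1..n}"
      by auto
    then show "0 \<le> (\<Sum>k\<le>n. sqrt_coeff k)"
      using sum_sqrt_coeff_le [of n] by (simp add: sum_negf)
  qed
qed

lemma Cauchy_product_sums_bilinear:
  fixes a :: "nat \<Rightarrow> 'a::banach" and b :: "nat \<Rightarrow> 'b::banach" and prod :: "'a \<Rightarrow> 'b \<Rightarrow> 'c::banach"
  assumes prod: "bounded_bilinear prod"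
    and a: "summable (\<lambda>k. norm (a k))" and b: "summable (\<lambda>k. norm (b k))"
  shows "(\<lambda>k. \<Sum>i\<le>k. prod (a i) (b (k - i))) sums prod (\<Sum>k. a k) (\<Sum>k. b k)"
proof -
  obtain K where K: "\<And>x y. norm (prod x y) \<le> norm x * norm y * K"
    using bounded_bilinear.bounded [OF prod] by blast
  let ?S1 = "\<lambda>n::nat. {..<n} \<times> {..<n}" and ?S2 = "\<lambda>n::nat. {(i, j). i + j < n}"
  let ?g = "\<lambda>(i, j). prod (a i) (b j)" and ?f = "\<lambda>(i, j). norm (a i) * norm (b j)"
  have S: "?S2 n \<subseteq> ?S1 n" "finite (?S1 n)" for n
    by auto
  have square_eq: "prod (\<Sum>k<n. a k) (\<Sum>k<n. b k) = sum ?g (?S1 n)" for n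
  proof -
    have "prod (\<Sum>k<n. a k) (\<Sum>k<n. b k) = (\<Sum>i<n. \<Sum>j<n. prod (a i) (b j))"
      by (simp only: bounded_bilinear.sum_left [OF prod]) (simp only: bounded_bilinear.sum_right [OF prod])
    then show ?thesis
      by (simp add: sum.cartesian_product)
  qed
  have "(\<lambda>n. prod (\<Sum>k<n. a k) (\<Sum>k<n. b k)) \<longlonglongrightarrow> prod (\<Sum>k. a k) (\<Sum>k. b k)"
    by (intro bounded_bilinear.tendsto [OF prod] summable_LIMSEQ summable_norm_cancel [OF a]
        summable_norm_cancel [OF b])
  then have square: "(\<lambda>n. sum ?g (?S1 n)) \<longlonglongrightarrow> prod (\<Sum>k. a k) (\<Sum>k. b k)"
    by (simp only: square_eq)
  text \<open>The part of the square outside the triangle is controlled by the scalar Cauchy product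
    of the norms.\<close>
  have "(\<lambda>n. (\<Sum>k<n. norm (a k)) * (\<Sum>k<n. norm (b k))
      - (\<Sum>k<n. \<Sum>i\<le>k. norm (a i) * norm (b (k - i))))
      \<longlonglongrightarrow> (\<Sum>k. norm (a k)) * (\<Sum>k. norm (b k)) - (\<Sum>k. norm (a k)) * (\<Sum>k. norm (b k))"
    using a b Cauchy_product_sums [of "\<lambda>k. norm (a k)" "\<lambda>k. norm (b k)"]
    by (intro tendsto_intros summable_LIMSEQ) (simp_all add: sums_def)
  then have outside: "(\<lambda>n. sum ?f (?S1 n - ?S2 n) * K) \<longlonglongrightarrow> 0"
    by (simp add: sum_diff S sum_product sum.cartesian_product sum.triangle_reindex tendsto_mult_left_zero)
  have "\<forall>n. norm (sum ?g (?S1 n - ?S2 n)) \<le> sum ?f (?S1 n - ?S2 n) * K"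
  proof
    fix n
    have "norm (sum ?g (?S1 n - ?S2 n)) \<le> (\<Sum>p\<in>?S1 n - ?S2 n. ?f p * K)"
      using K by (intro order_trans [OF norm_sum sum_mono]) auto
    then show "norm (sum ?g (?S1 n - ?S2 n)) \<le> sum ?f (?S1 n - ?S2 n) * K"
      by (simp add: sum_distrib_right)
  qed
  then have "(\<lambda>n. sum ?g (?S1 n - ?S2 n)) \<longlonglongrightarrow> 0"
    by (rule Lim_null_comparison [OF always_eventually outside])
  then have "(\<lambda>n. sum ?g (?S1 n) - sum ?g (?S2 n)) \<longlonglongrightarrow> 0"
    by (simp add: sum_diff S)
  with square have "(\<lambda>n. sum ?g (?S2 n)) \<longlonglongrightarrow> prod (\<Sum>k. a k) (\<Sum>k. b k)"
    by (rule Lim_transform2)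
  then show ?thesis
    by (simp only: sums_def sum.triangle_reindex)
qed

section \<open>Square roots of positive contractions\<close>

lemma bounded_clinearI:
  assumes "\<And>x y. A (x + y) = A x + A y" "\<And>c x. A (c *\<^sub>C x) = c *\<^sub>C A x"
    "\<And>x. norm (A x) \<le> norm x * K"
  shows "bounded_clinear A"
  using assms unfolding bounded_clinear_def clinear_def clinear_on_def csubspace_def by blast

lemma bounded_clinear_add: "bounded_clinear A \<Longrightarrow> A (x + y) = A x + A y"
  and bounded_clinear_scaleC: "bounded_clinear A \<Longrightarrow> A (c *\<^sub>C x) = c *\<^sub>C A x"
  unfolding bounded_clinear_def clinear_def clinear_on_def by blast+

lemma bounded_clinear_imp_bounded_linear:
  assumes "bounded_clinear A"
  shows "bounded_linear A"
proof
  show "A (r *\<^sub>R x) = r *\<^sub>R A x" for r x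
    by (simp add: scaleR_scaleC bounded_clinear_scaleC [OF assms])
  show "\<exists>K. \<forall>x. norm (A x) \<le> norm x * K"
    using assms unfolding bounded_clinear_def by blast
qed (rule bounded_clinear_add [OF assms])

lemma bounded_clinear_diff: "bounded_clinear A \<Longrightarrow> A (x - y) = A x - A y"
  by (rule linear_diff [OF bounded_linear.linear [OF bounded_clinear_imp_bounded_linear]])

lemma bounded_clinear_0: "bounded_clinear A \<Longrightarrow> A 0 = 0"
  using bounded_clinear_scaleC [of A 0 0] by simp

lemma positive_op_selfadjoint:
  fixes P :: "'a::complex_inner \<Rightarrow> 'a"
  assumes "bounded_clinear P" "positive_op P"
  shows "cinner (P y) z = cinner y (P z)"
proof -
  have real: "Im (cinner u (P u)) = 0" for u
    using assms(2) unfolding positive_op_def by blast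
  let ?a = "cinner y (P z)" and ?b = "cinner z (P y)"
  have "Im (?a + ?b) = 0"
    using real [of "y + z"] real [of y] real [of z]
    by (simp add: bounded_clinear_add [OF assms(1)] cinner_add_left cinner_add_right)
  moreover have "Im (\<i> * ?a - \<i> * ?b) = 0"
    using real [of "y + \<i> *\<^sub>C z"] real [of y] real [of z]
    by (simp add: bounded_clinear_add [OF assms(1)] bounded_clinear_scaleC [OF assms(1)]
        cinner_add_left cinner_add_right cinner_scaleC_left cinner_scaleC_right algebra_simps)
  ultimately have "?a = cnj ?b"
    by (simp add: complex_eq_iff)
  then show ?thesis
    by (metis cinner_commute)
qed

text \<open>If \<open>\<langle>y, P y\<rangle> = 0\<close>, positivity at \<open>y - s P y\<close> for small \<open>s > 0\<close> forces \<open>P y = 0\<close>.\<close>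

lemma positive_op_form_eq_0:
  fixes P :: "'a::complex_inner \<Rightarrow> 'a"
  assumes P: "bounded_clinear P" "positive_op P" and y: "Re (cinner y (P y)) = 0"
  shows "P y = 0"
proof (rule ccontr)
  assume "P y \<noteq> 0"
  let ?z = "P y"
  let ?q = "(norm ?z)\<^sup>2" and ?c = "Re (cinner ?z (P ?z))"
  have nonneg: "0 \<le> Re (cinner u (P u))" for u
    using P(2) unfolding positive_op_def by blast
  have q: "0 < ?q"
    using \<open>P y \<noteq> 0\<close> by simp
  define s where "s = ?q / (?c + 1)"
  have s: "0 < s"
    unfolding s_def using q nonneg [of ?z] by simp
  have "cinner (y - s *\<^sub>R ?z) (P (y - s *\<^sub>R ?z))
      = cinner y (P y) - of_real s * cinner y (P ?z) - of_real s * cinner ?z (P y)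
        + of_real s * of_real s * cinner ?z (P ?z)"
    using bounded_linear.linear [OF bounded_clinear_imp_bounded_linear [OF P(1)]]
    by (simp add: linear_diff linear_scale cinner_diff_left cinner_diff_right cinner_scaleR_left
        cinner_scaleR_right algebra_simps)
  moreover have "cinner y (P ?z) = cinner ?z ?z"
    using positive_op_selfadjoint [OF P] by simp
  ultimately have "0 \<le> - 2 * s * ?q + s * s * ?c"
    using nonneg [of "y - s *\<^sub>R ?z"] y by (simp add: cinner_self)
  then have "2 * ?q \<le> s * ?c"
    using s by (simp add: algebra_simps power2_eq_square)
  also have "\<dots> = ?q * (?c / (?c + 1))"
    unfolding s_def by simp
  also have "\<dots> \<le> ?q"
    using q nonneg [of ?z] by (intro mult_left_le) auto
  finally show False
    using q by simp
qed

locale positive_contraction =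
  fixes B :: "'a::chilbert_space \<Rightarrow> 'a"
  assumes add: "\<And>x y. B (x + y) = B x + B y"
    and scaleC: "\<And>c x. B (c *\<^sub>C x) = c *\<^sub>C B x"
    and selfadjoint: "\<And>x y. cinner (B x) y = cinner x (B y)"
    and norm_sq_le: "\<And>x. (norm (B x))\<^sup>2 \<le> Re (cinner x (B x))"
begin

text \<open>\<open>W = I - B\<close> is a self-adjoint contraction, and \<open>sqrt B = sqrt (I - W) = \<Sum>n. c\<^sub>n W\<^sup>n\<close>
  with the coefficients \<open>c\<^sub>n\<close> of the binomial series above.\<close>

definition W :: "'a \<Rightarrow> 'a" where
  "W x = x - B x"

lemma norm_W_le: "norm (W x) \<le> norm x"
proof -
  have "(norm (W x))\<^sup>2 = (norm x)\<^sup>2 + (norm (B x))\<^sup>2 - 2 * Re (cinner x (B x))"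
    by (simp add: W_def norm_diff_sq)
  then have "(norm (W x))\<^sup>2 \<le> (norm x)\<^sup>2"
    using norm_sq_le [of x] zero_le_power2 [of "norm (B x)"] by linarith
  then show ?thesis
    by (rule power2_le_imp_le) simp
qed

lemma bounded_linear_W: "bounded_linear W"
proof
  show "\<exists>K. \<forall>x. norm (W x) \<le> norm x * K"
    using norm_W_le by (intro exI [of _ 1]) simp
qed (simp_all add: W_def add scaleR_scaleC scaleC scaleC_diff_right)

lemma
  shows bounded_linear_W_pow: "bounded_linear (W ^^ n)"
    and W_pow_scaleC: "(W ^^ n) (c *\<^sub>C x) = c *\<^sub>C (W ^^ n) x"
    and W_pow_selfadjoint: "cinner ((W ^^ n) x) y = cinner x ((W ^^ n) y)"
    and norm_W_pow_le: "norm ((W ^^ n) x) \<le> norm x"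
proof (induction n arbitrary: x y)
  case (Suc n)
  case 1 show ?case
    using Suc.IH(1) bounded_linear_W by (simp add: bounded_linear_compose)
  case 2 show ?case
    using Suc.IH(2) by (simp add: W_def scaleC scaleC_diff_right)
  case 3
  have "cinner ((W ^^ Suc n) x) y = cinner ((W ^^ n) x) (W y)"
    by (simp add: W_def cinner_diff_left cinner_diff_right selfadjoint)
  also have "\<dots> = cinner x ((W ^^ Suc n) y)"
    by (simp only: Suc.IH(3) funpow_Suc_right comp_def)
  finally show ?case .
  case 4 show ?case
    using order_trans [OF norm_W_le Suc.IH(4)] by simp
qed (simp_all add: id_def bounded_linear_ident)

lemma norm_blinfun_W_pow_le: "norm (Blinfun (W ^^ n)) \<le> 1"
  by (rule norm_blinfun_bound) (simp_all add: bounded_linear_Blinfun_apply [OF bounded_linear_W_pow]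
      norm_W_pow_le)

lemma summable_norm_sqrt_terms: "summable (\<lambda>n. norm (sqrt_coeff n *\<^sub>R Blinfun (W ^^ n)))"
  using norm_blinfun_W_pow_le
  by (intro summable_comparison_test' [OF summable_abs_sqrt_coeff]) (simp add: mult_left_le)

definition sqrt_series :: "'a \<Rightarrow>\<^sub>L 'a" where
  "sqrt_series = (\<Sum>n. sqrt_coeff n *\<^sub>R Blinfun (W ^^ n))"

abbreviation root :: "'a \<Rightarrow> 'a" where
  "root \<equiv> blinfun_apply sqrt_series"

lemma
  shows summable_sqrt_series_apply: "summable (\<lambda>n. sqrt_coeff n *\<^sub>R (W ^^ n) x)"
    and sqrt_series_apply: "root x = (\<Sum>n. sqrt_coeff n *\<^sub>R (W ^^ n) x)"
proof -
  note apply_at = bounded_bilinear.bounded_linear_left [OF bounded_bilinear_blinfun_apply, of x]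
  note summable = summable_norm_cancel [OF summable_norm_sqrt_terms]
  have "blinfun_apply (sqrt_coeff n *\<^sub>R Blinfun (W ^^ n)) x = sqrt_coeff n *\<^sub>R (W ^^ n) x" for n
    by (simp add: blinfun.scaleR_left bounded_linear_Blinfun_apply [OF bounded_linear_W_pow])
  then show "summable (\<lambda>n. sqrt_coeff n *\<^sub>R (W ^^ n) x)" "root x = (\<Sum>n. sqrt_coeff n *\<^sub>R (W ^^ n) x)"
    using bounded_linear.summable [OF apply_at summable] bounded_linear.suminf [OF apply_at summable]
    by (simp_all add: sqrt_series_def)
qed

lemma root_square: "root (root x) = B x"
proof -
  let ?T = "\<lambda>n. sqrt_coeff n *\<^sub>R Blinfun (W ^^ n)"
  let ?d = "\<lambda>k. if k = 0 then 1 else if k = 1 then -1 else (0::real)"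
  have "?T i o\<^sub>L ?T j = (sqrt_coeff i * sqrt_coeff j) *\<^sub>R Blinfun (W ^^ (i + j))" for i j
  proof (rule blinfun_eqI)
    fix v
    have "(W ^^ (i + j)) v = (W ^^ i) ((W ^^ j) v)"
      by (simp add: funpow_add)
    then show "blinfun_apply (?T i o\<^sub>L ?T j) v
        = blinfun_apply ((sqrt_coeff i * sqrt_coeff j) *\<^sub>R Blinfun (W ^^ (i + j))) v"
      by (simp add: blinfun.scaleR_left bounded_linear_Blinfun_apply [OF bounded_linear_W_pow]
          linear_scale [OF bounded_linear.linear [OF bounded_linear_W_pow]])
  qed
  then have "(\<Sum>i\<le>k. ?T i o\<^sub>L ?T (k - i)) = ?d k *\<^sub>R Blinfun (W ^^ k)" for k
    by (simp add: scaleR_sum_left [symmetric] sqrt_coeff_convolution)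
  then have "(\<lambda>k. ?d k *\<^sub>R Blinfun (W ^^ k)) sums (sqrt_series o\<^sub>L sqrt_series)"
    using Cauchy_product_sums_bilinear [OF bounded_bilinear_blinfun_compose summable_norm_sqrt_terms
        summable_norm_sqrt_terms] by (simp add: sqrt_series_def)
  moreover have "(\<lambda>k. (if k = 0 then Blinfun (W ^^ k) else 0) + (if k = 1 then - Blinfun (W ^^ k) else 0))
      sums (Blinfun (W ^^ 0) + - Blinfun (W ^^ 1))"
    by (intro sums_add sums_single)
  moreover have "(\<lambda>k. (if k = 0 then Blinfun (W ^^ k) else 0) + (if k = 1 then - Blinfun (W ^^ k) else 0))
      = (\<lambda>k. ?d k *\<^sub>R Blinfun (W ^^ k))"
    by auto
  ultimately have "sqrt_series o\<^sub>L sqrt_series = Blinfun (W ^^ 0) - Blinfun (W ^^ 1)"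
    using sums_unique2 by fastforce
  then show ?thesis
    by (simp add: blinfun.diff_left bounded_linear_Blinfun_apply [OF bounded_linear_W]
        bounded_linear_Blinfun_apply [OF bounded_linear_ident [unfolded id_def [symmetric]]] W_def
        flip: blinfun_apply_blinfun_compose)
qed

lemma bounded_clinear_root: "bounded_clinear root"
proof (rule bounded_clinearI)
  show "root (x + y) = root x + root y" for x y
    by (simp add: blinfun.add_right)
  show "root (c *\<^sub>C x) = c *\<^sub>C root x" for c x
    using bounded_linear.suminf [OF bounded_linear_scaleC summable_sqrt_series_apply, of c x]
    by (simp add: sqrt_series_apply W_pow_scaleC scaleR_scaleC_commute)
  show "norm (root x) \<le> norm x * norm sqrt_series" for x
    using norm_blinfun [of sqrt_series x] by (simp add: mult.commute)
qed

lemma positive_op_root: "positive_op root"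
  unfolding positive_op_def
proof
  fix x
  let ?z = "\<lambda>n. cinner x (sqrt_coeff n *\<^sub>R (W ^^ n) x)"
  have z: "?z sums cinner x (root x)"
    unfolding sqrt_series_apply
    by (rule bounded_linear.sums [OF bounded_linear_cinner_right summable_sqrt_series_apply [THEN summable_sums]])
  have "Im (?z n) = 0" for n
  proof -
    have "cinner x ((W ^^ n) x) = cnj (cinner x ((W ^^ n) x))"
      by (metis W_pow_selfadjoint cinner_commute)
    then have "Im (cinner x ((W ^^ n) x)) = 0"
      by (metis Reals_cnj_iff complex_is_Real_iff)
    then show ?thesis
      by (simp add: cinner_scaleR_right)
  qed
  then have "Im (cinner x (root x)) = 0"
    using sums_unique [OF sums_zero] bounded_linear.sums [OF bounded_linear_Im z] by (simp add: sums_unique2)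
  text \<open>Only \<open>c\<^sub>0 = 1\<close> is positive, and \<open>\<Sum>n. c\<^sub>n \<ge> 0\<close>.\<close>
  have "sqrt_coeff n * (norm x)\<^sup>2 \<le> Re (?z n)" for n
  proof (cases "n = 0")
    case False
    have "Re (cinner x ((W ^^ n) x)) \<le> norm x * norm x"
      using Re_cinner_le [of x "(W ^^ n) x"] norm_W_pow_le [of n x] by (simp add: mult_left_mono order_trans)
    then show ?thesis
      using sqrt_coeff_nonpos [of n] False
      by (simp add: cinner_scaleR_right power2_eq_square mult_left_mono_neg)
  qed (simp add: cinner_scaleR_right Re_cinner_self)
  moreover have re: "(\<lambda>n. Re (?z n)) sums Re (cinner x (root x))"
    by (rule bounded_linear.sums [OF bounded_linear_Re z])
  ultimately have "(\<Sum>n. sqrt_coeff n * (norm x)\<^sup>2) \<le> Re (cinner x (root x))"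
    using suminf_le [OF _ summable_mult2 [OF summable_sqrt_coeff] sums_summable [OF re]]
    by (simp add: sums_unique [OF re, symmetric])
  moreover have "0 \<le> (\<Sum>n. sqrt_coeff n * (norm x)\<^sup>2)"
    using suminf_sqrt_coeff_nonneg by (simp add: suminf_mult2 [OF summable_sqrt_coeff, symmetric])
  ultimately have "0 \<le> Re (cinner x (root x))"
    by linarith
  with \<open>Im (cinner x (root x)) = 0\<close> show "Im (cinner x (root x)) = 0 \<and> 0 \<le> Re (cinner x (root x))"
    by blast
qed

lemma root_commute:
  assumes "bounded_clinear A" and "\<And>x. A (B x) = B (A x)"
  shows "A (root x) = root (A x)"
proof -
  have A: "bounded_linear A"
    by (rule bounded_clinear_imp_bounded_linear [OF assms(1)])
  have "A ((W ^^ n) y) = (W ^^ n) (A y)" for n y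
    by (induction n) (simp_all add: W_def assms(2) linear_diff [OF bounded_linear.linear [OF A]])
  then show ?thesis
    using bounded_linear.suminf [OF A summable_sqrt_series_apply]
    by (simp add: sqrt_series_apply linear_scale [OF bounded_linear.linear [OF A]])
qed

text \<open>A second positive square root \<open>A\<close> commutes with \<open>B = A\<^sup>2\<close>, hence with \<open>root\<close>;
  for \<open>y = root x - A x\<close> this gives \<open>root y + A y = (root\<^sup>2 - A\<^sup>2) x = 0\<close>, so both
  positive forms vanish at \<open>y\<close>.\<close>

lemma root_unique:
  assumes A: "bounded_clinear A" "positive_op A" and sq: "\<And>x. A (A x) = B x"
  shows "A = root"
proof
  fix x
  let ?y = "root x - A x"
  have "A (B y) = B (A y)" for y
    by (simp flip: sq)
  then have "root ?y + A ?y = 0"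
    using root_square [of x] sq [of x] root_commute [OF A(1), of x]
    by (simp add: bounded_clinear_diff [OF bounded_clinear_root] bounded_clinear_diff [OF A(1)])
  then have "cinner ?y (root ?y) + cinner ?y (A ?y) = 0"
    by (simp flip: cinner_add_right)
  moreover have "0 \<le> Re (cinner ?y (root ?y))" "0 \<le> Re (cinner ?y (A ?y))"
    using positive_op_root A(2) unfolding positive_op_def by blast+
  ultimately have "Re (cinner ?y (root ?y)) = 0" "Re (cinner ?y (A ?y)) = 0"
    by (metis add.commute add_nonneg_eq_0_iff plus_complex.sel(1) zero_complex.sel(1))+
  then have "root ?y = 0" "A ?y = 0"
    using positive_op_form_eq_0 [OF bounded_clinear_root positive_op_root]
      positive_op_form_eq_0 [OF A(1,2)] by blast+
  then have "cinner ?y ?y = 0"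
    using positive_op_selfadjoint [OF bounded_clinear_root positive_op_root, of ?y x]
      positive_op_selfadjoint [OF A(1,2), of ?y x] by (simp add: cinner_diff_right)
  then show "A x = root x"
    by (simp add: cinner_eq_zero_iff)
qed

lemma op_sqrt_eq: "op_sqrt B = root"
proof -
  have "\<exists>!A. bounded_clinear A \<and> positive_op A \<and> (\<forall>x. A (A x) = B x)"
    using bounded_clinear_root positive_op_root root_square root_unique by blast
  then have "bounded_clinear (op_sqrt B) \<and> positive_op (op_sqrt B) \<and> (\<forall>x. op_sqrt B (op_sqrt B x) = B x)"
    unfolding op_sqrt_def by (rule theI')
  then show ?thesis
    using root_unique by blast
qed

end

lemma
  assumes "positive_contraction B"
  shows bounded_clinear_op_sqrt: "bounded_clinear (op_sqrt B)"
    and positive_op_sqrt: "positive_op (op_sqrt B)"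
    and op_sqrt_square: "op_sqrt B (op_sqrt B x) = B x"
  using positive_contraction.bounded_clinear_root [OF assms] positive_contraction.positive_op_root [OF assms]
    positive_contraction.root_square [OF assms]
  by (simp_all add: positive_contraction.op_sqrt_eq [OF assms])

section \<open>The square root of \<open>(I + L\<^sup>*L)\<^sup>-\<^sup>1\<close>\<close>

lemma
  assumes "clinear_on E L"
  shows clinear_on_add: "x \<in> E \<Longrightarrow> y \<in> E \<Longrightarrow> L (x + y) = L x + L y"
    and clinear_on_scaleC: "x \<in> E \<Longrightarrow> L (c *\<^sub>C x) = c *\<^sub>C L x"
    and clinear_on_csubspace: "csubspace E"
  using assms by (simp_all add: clinear_on_def)

lemma clinear_on_0:
  assumes "clinear_on E L"
  shows "L 0 = 0"
  using clinear_on_scaleC [OF assms, of 0 0] csubspace_0 [OF clinear_on_csubspace [OF assms]] by simp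

lemma clinear_on_diff:
  assumes "clinear_on E L" "x \<in> E" "y \<in> E"
  shows "L (x - y) = L x - L y"
  using clinear_on_add [OF assms(1), of "x - y" y] csubspace_diff [OF clinear_on_csubspace [OF assms(1)]] assms
  by (simp add: eq_diff_eq)

lemma sequence_in_range_tendsto:
  fixes f :: "'a \<Rightarrow> 'b::metric_space"
  assumes "u \<in> closure (range f)"
  obtains z where "(\<lambda>n. f (z n)) \<longlonglongrightarrow> u"
proof -
  have "\<exists>s. (\<forall>n. s n \<in> range f) \<and> s \<longlonglongrightarrow> u"
    using assms by (simp only: closure_sequential)
  then obtain s where s: "\<forall>n. s n \<in> range f" "s \<longlonglongrightarrow> u"
    by blast
  then have "\<forall>n. \<exists>a. s n = f a"
    by blast
  then obtain z where "\<forall>n. s n = f (z n)"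
    by (metis choice)
  then have "s = (\<lambda>n. f (z n))"
    by (simp add: fun_eq_iff)
  with s(2) show ?thesis
    using that by simp
qed

lemma Cauchy_if_norm_diff_le:
  fixes f :: "nat \<Rightarrow> 'a::real_normed_vector" and g :: "nat \<Rightarrow> 'b::real_normed_vector"
  assumes "Cauchy f" "\<And>m n. norm (g m - g n) \<le> norm (f m - f n)"
  shows "Cauchy g"
  using assms by (metis (no_types, lifting) CauchyD CauchyI order.strict_trans1)

text \<open>\<open>B = (I + L\<^sup>*L)\<^sup>-\<^sup>1\<close> is described without the adjoint: \<open>B h \<in> E\<close> and
  \<open>\<langle>x, h\<rangle> = \<langle>x, B h\<rangle> + \<langle>L x, L (B h)\<rangle>\<close> for \<open>x \<in> E\<close>, i.e. \<open>h\<close> is represented by \<open>B h\<close> in the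
  graph inner product.\<close>

locale graph_resolvent =
  fixes B :: "'a::chilbert_space \<Rightarrow> 'a" and E :: "'a set" and L :: "'a \<Rightarrow> 'b::chilbert_space"
  assumes linear: "clinear_on E L"
    and closed_graph: "closed (op_graph E L)"
    and in_domain: "\<And>h. B h \<in> E"
    and graph_form: "\<And>x h. x \<in> E \<Longrightarrow> cinner x h = cinner x (B h) + cinner (L x) (L (B h))"
    and injective: "\<And>h. B h = 0 \<Longrightarrow> h = 0"
begin

lemma eq_0_if_graph_orthogonal:
  assumes "d \<in> E" and "\<And>x. x \<in> E \<Longrightarrow> cinner x d + cinner (L x) (L d) = 0"
  shows "d = 0"
proof -
  have "(norm d)\<^sup>2 + (norm (L d))\<^sup>2 = 0"
    using assms(2) [OF assms(1)] by (metis cinner_self of_real_add of_real_eq_0_iff)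
  then show ?thesis
    by (simp add: add_nonneg_eq_0_iff)
qed

lemma B_add: "B (h + k) = B h + B k"
proof -
  let ?d = "B (h + k) - (B h + B k)"
  have E: "csubspace E"
    by (rule clinear_on_csubspace [OF linear])
  have dE: "?d \<in> E"
    using E in_domain by (intro csubspace_diff csubspace_add)
  have Ld: "L ?d = L (B (h + k)) - (L (B h) + L (B k))"
    using E in_domain by (simp add: clinear_on_diff [OF linear] clinear_on_add [OF linear] csubspace_add)
  show ?thesis
  proof (rule eq_iff_diff_eq_0 [THEN iffD2], rule eq_0_if_graph_orthogonal [OF dE])
    fix x assume x: "x \<in> E"
    show "cinner x ?d + cinner (L x) (L ?d) = 0"
      using graph_form [OF x, of "h + k"] graph_form [OF x, of h] graph_form [OF x, of k]
      by (simp add: Ld cinner_diff_right cinner_add_right algebra_simps)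
  qed
qed

lemma B_scaleC: "B (c *\<^sub>C h) = c *\<^sub>C B h"
proof -
  let ?d = "B (c *\<^sub>C h) - c *\<^sub>C B h"
  have E: "csubspace E"
    by (rule clinear_on_csubspace [OF linear])
  have dE: "?d \<in> E"
    using E in_domain by (intro csubspace_diff csubspace_scaleC)
  have Ld: "L ?d = L (B (c *\<^sub>C h)) - c *\<^sub>C L (B h)"
    using E in_domain by (simp add: clinear_on_diff [OF linear] clinear_on_scaleC [OF linear] csubspace_scaleC)
  show ?thesis
  proof (rule eq_iff_diff_eq_0 [THEN iffD2], rule eq_0_if_graph_orthogonal [OF dE])
    fix x assume x: "x \<in> E"
    show "cinner x ?d + cinner (L x) (L ?d) = 0"
      using graph_form [OF x, of "c *\<^sub>C h"] graph_form [OF x, of h]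
      by (simp add: Ld cinner_diff_right cinner_scaleC_right algebra_simps)
  qed
qed

lemma cinner_B_left: "cinner (B h) k = cinner (B h) (B k) + cinner (L (B h)) (L (B k))"
  using graph_form [OF in_domain] .

lemma B_selfadjoint: "cinner (B h) k = cinner h (B k)"
  using cinner_B_left [of h k] cinner_B_left [of k h] by (metis cinner_commute complex_cnj_add)

lemma Re_cinner_B: "Re (cinner h (B h)) = (norm (B h))\<^sup>2 + (norm (L (B h)))\<^sup>2"
  using cinner_B_left [of h h] by (simp add: Re_cinner_self Re_cinner_commute [of h])

sublocale positive_contraction B
  by standard (simp_all add: B_add B_scaleC B_selfadjoint Re_cinner_B)

abbreviation R :: "'a \<Rightarrow> 'a" where
  "R \<equiv> op_sqrt B"

lemma
  shows R_add: "R (x + y) = R x + R y"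
    and R_scaleC: "R (c *\<^sub>C x) = c *\<^sub>C R x"
    and R_diff: "R (x - y) = R x - R y"
    and R_0: "R 0 = 0"
    and R_selfadjoint: "cinner (R x) y = cinner x (R y)"
    and R_R: "R (R x) = B x"
    and bounded_linear_R: "bounded_linear R"
  using bounded_clinear_op_sqrt [OF positive_contraction_axioms]
    positive_op_sqrt [OF positive_contraction_axioms] op_sqrt_square [OF positive_contraction_axioms]
  by (simp_all add: bounded_clinear_add bounded_clinear_scaleC bounded_clinear_diff bounded_clinear_0
      positive_op_selfadjoint bounded_clinear_imp_bounded_linear)

lemma B_diff: "B (x - y) = B x - B y"
  by (metis R_R R_diff)

lemma norm_graph_B_sq: "(norm (B z))\<^sup>2 + (norm (L (B z)))\<^sup>2 = (norm (R z))\<^sup>2"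
proof -
  have "cinner z (B z) = cinner (R z) (R z)"
    by (simp flip: R_R add: R_selfadjoint)
  then show ?thesis
    by (simp flip: Re_cinner_B add: Re_cinner_self)
qed

lemma closure_range_R: "closure (range R) = UNIV"
proof -
  have "UNIV \<subseteq> closure (range R)"
  proof (rule closure_dense_csubspace [OF csubspace_range [OF R_add R_scaleC] _ csubspace_UNIV])
    fix v assume "\<forall>m\<in>range R. cinner m v = 0"
    then have "R v = 0"
      by (intro eq_0_if_orthogonal_all) (simp add: R_selfadjoint)
    then show "v = 0"
      by (metis R_0 R_R injective)
  qed auto
  then show ?thesis
    by blast
qed

text \<open>\<open>R\<close> is an isometry from \<open>H\<close> onto \<open>E\<close> with the graph norm: on \<open>range R\<close> this is
  the previous identity, and the closed graph carries it over to limits.\<close>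

lemma R_graph_isometry: "R u \<in> E \<and> (norm (R u))\<^sup>2 + (norm (L (R u)))\<^sup>2 = (norm u)\<^sup>2"
proof -
  obtain z where z: "(\<lambda>n. R (z n)) \<longlonglongrightarrow> u"
    using closure_range_R sequence_in_range_tendsto [of u R] by blast
  have Bz: "(\<lambda>n. B (z n)) \<longlonglongrightarrow> R u"
    using bounded_linear.tendsto [OF bounded_linear_R z] by (simp add: R_R)
  have "norm (L (B (z m)) - L (B (z n))) \<le> norm (R (z m) - R (z n))" for m n
  proof -
    have "(norm (L (B (z m - z n))))\<^sup>2 \<le> (norm (R (z m - z n)))\<^sup>2"
      using norm_graph_B_sq [of "z m - z n"] zero_le_power2 [of "norm (B (z m - z n))"] by linarith
    then show ?thesis
      using power2_le_imp_le by (simp add: B_diff R_diff clinear_on_diff [OF linear] in_domain)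
  qed
  then have "Cauchy (\<lambda>n. L (B (z n)))"
    by (rule Cauchy_if_norm_diff_le [OF LIMSEQ_imp_Cauchy [OF z]])
  then obtain w where w: "(\<lambda>n. L (B (z n))) \<longlonglongrightarrow> w"
    using Cauchy_convergent_iff convergent_def by blast
  have "(w, R u) \<in> op_graph E L"
    using closed_sequentially [OF closed_graph _ tendsto_Pair [OF w Bz]] in_domain
    by (auto simp: op_graph_def)
  then have "R u \<in> E" and w_eq: "w = L (R u)"
    by (auto simp: op_graph_def)
  have "(\<lambda>n. (norm (B (z n)))\<^sup>2 + (norm (L (B (z n))))\<^sup>2) \<longlonglongrightarrow> (norm (R u))\<^sup>2 + (norm w)\<^sup>2"
    using Bz w by (intro tendsto_intros)
  moreover have "(\<lambda>n. (norm (B (z n)))\<^sup>2 + (norm (L (B (z n))))\<^sup>2) \<longlonglongrightarrow> (norm u)\<^sup>2"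
    unfolding norm_graph_B_sq using z by (intro tendsto_intros)
  ultimately show ?thesis
    using \<open>R u \<in> E\<close> w_eq LIMSEQ_unique by blast
qed

lemma R_in_domain: "R u \<in> E"
  and norm_graph_R_sq: "(norm (R u))\<^sup>2 + (norm (L (R u)))\<^sup>2 = (norm u)\<^sup>2"
  using R_graph_isometry by blast+

lemma norm_R_le: "norm (R u) \<le> norm u"
proof -
  have "(norm (R u))\<^sup>2 \<le> (norm u)\<^sup>2"
    using norm_graph_R_sq [of u] zero_le_power2 [of "norm (L (R u))"] by linarith
  then show ?thesis
    by (rule power2_le_imp_le) simp
qed

lemma op_graph_subset_closure_range_B: "op_graph E L \<subseteq> closure (range (\<lambda>z. (L (B z), B z)))"
proof (rule closure_dense_csubspace)
  show "csubspace (range (\<lambda>z. (L (B z), B z)))"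
    by (rule csubspace_range)
      (simp_all add: B_add B_scaleC clinear_on_add [OF linear] clinear_on_scaleC [OF linear] in_domain)
  show "range (\<lambda>z. (L (B z), B z)) \<subseteq> op_graph E L"
    by (auto simp: op_graph_def in_domain)
  show "csubspace (op_graph E L)"
    by (rule csubspace_op_graph [OF linear])
  show "closed (op_graph E L)"
    by (rule closed_graph)
  fix v assume "v \<in> op_graph E L" and orth: "\<forall>m\<in>range (\<lambda>z. (L (B z), B z)). cinner m v = 0"
  then obtain y where y: "y \<in> E" "v = (L y, y)"
    by (auto simp: op_graph_def)
  have "cinner z y = 0" for z
  proof -
    have "cnj (cinner y z) = cinner (L (B z)) (L y) + cinner (B z) y"
      using graph_form [OF y(1), of z] by (simp add: cinner_commute [of "L (B z)"] cinner_commute [of "B z"])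
    also have "\<dots> = 0"
      using orth y(2) by (simp add: cinner_Pair add.commute)
    finally show ?thesis
      by (metis cinner_commute)
  qed
  then have "y = 0"
    by (rule eq_0_if_orthogonal_all)
  then show "v = 0"
    using y(2) clinear_on_0 [OF linear] by (simp add: zero_prod_def)
qed

lemma R_surjective:
  assumes "x \<in> E"
  obtains u where "x = R u"
proof -
  have "(L x, x) \<in> closure (range (\<lambda>z. (L (B z), B z)))"
    using assms op_graph_subset_closure_range_B by (auto simp: op_graph_def)
  then obtain z where z: "(\<lambda>n. (L (B (z n)), B (z n))) \<longlonglongrightarrow> (L x, x)"
    by (rule sequence_in_range_tendsto)
  have "norm (R (z m) - R (z n)) \<le> norm ((L (B (z m)), B (z m)) - (L (B (z n)), B (z n)))" for m n
  proof -
    have "(norm (R (z m) - R (z n)))\<^sup>2 = (norm ((L (B (z m)), B (z m)) - (L (B (z n)), B (z n))))\<^sup>2"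
      using norm_graph_B_sq [of "z m - z n"]
      by (simp add: norm_Pair_sq R_diff B_diff clinear_on_diff [OF linear] in_domain add.commute)
    then show ?thesis
      by simp
  qed
  then have "Cauchy (\<lambda>n. R (z n))"
    by (rule Cauchy_if_norm_diff_le [OF LIMSEQ_imp_Cauchy [OF z]])
  then obtain u where u: "(\<lambda>n. R (z n)) \<longlonglongrightarrow> u"
    using Cauchy_convergent_iff convergent_def by blast
  have "(\<lambda>n. B (z n)) \<longlonglongrightarrow> R u"
    using bounded_linear.tendsto [OF bounded_linear_R u] by (simp add: R_R)
  moreover have "(\<lambda>n. B (z n)) \<longlonglongrightarrow> x"
    using tendsto_snd [OF z] by simp
  ultimately show ?thesis
    using that LIMSEQ_unique by blast
qed

end

section \<open>Closed densely defined operators\<close>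

lemma eq_0_if_orthogonal_dense:
  fixes D :: "'a::complex_inner set"
  assumes "densely_defined D" "\<And>x. x \<in> D \<Longrightarrow> cinner x v = 0"
  shows "v = 0"
proof -
  obtain f where f: "\<forall>n. f n \<in> D" "f \<longlonglongrightarrow> v"
    using assms(1) closure_sequential [of v D] unfolding densely_defined_def by blast
  have "(\<lambda>n. cinner (f n) v) \<longlonglongrightarrow> cinner v v"
    using f(2) by (intro tendsto_cinner tendsto_const)
  moreover have "(\<lambda>n. cinner (f n) v) = (\<lambda>n. 0)"
    using f(1) assms(2) by simp
  ultimately have "cinner v v = 0"
    using LIMSEQ_unique tendsto_const by metis
  then show ?thesis
    by (simp add: cinner_eq_zero_iff)
qed

locale closed_densely_defined =
  fixes D :: "'a::chilbert_space set" and A :: "'a \<Rightarrow> 'b::chilbert_space"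
  assumes linear: "clinear_on D A" and dense: "densely_defined D" and closed: "closed_op D A"
begin

lemma A_diff: "x \<in> D \<Longrightarrow> y \<in> D \<Longrightarrow> A (x - y) = A x - A y"
  by (rule clinear_on_diff [OF linear])

lemma A_0: "A 0 = 0"
  by (rule clinear_on_0 [OF linear])

lemma csubspace_D: "csubspace D"
  by (rule clinear_on_csubspace [OF linear])

lemma adj_unique: "(\<And>x. x \<in> D \<Longrightarrow> cinner x z = cinner x z') \<Longrightarrow> z = z'"
  using eq_0_if_orthogonal_dense [OF dense, of "z - z'"] by (simp add: cinner_diff_right)

lemma adj_cinner:
  assumes "y \<in> adj_dom D A" "x \<in> D"
  shows "cinner (A x) y = cinner x (adj D A y)"
proof -
  obtain z where "\<forall>x\<in>D. cinner (A x) y = cinner x z"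
    using assms(1) by (auto simp: adj_dom_def)
  then have "\<exists>!z. \<forall>x\<in>D. cinner (A x) y = cinner x z"
    using adj_unique by metis
  then have "\<forall>x\<in>D. cinner (A x) y = cinner x (adj D A y)"
    unfolding adj_def by (rule theI')
  then show ?thesis
    using assms(2) by blast
qed

lemma adj_eqI:
  assumes "\<And>x. x \<in> D \<Longrightarrow> cinner (A x) y = cinner x z"
  shows adj_domI: "y \<in> adj_dom D A" and adj_eq: "adj D A y = z"
proof -
  show y: "y \<in> adj_dom D A"
    using assms by (auto simp: adj_dom_def)
  show "adj D A y = z"
    using adj_cinner [OF y] assms by (metis adj_unique)
qed

lemma clinear_on_adj: "clinear_on (adj_dom D A) (adj D A)"
proof -
  have add: "y + y' \<in> adj_dom D A \<and> adj D A (y + y') = adj D A y + adj D A y'"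
    if "y \<in> adj_dom D A" "y' \<in> adj_dom D A" for y y'
    using that adj_eqI [of "y + y'" "adj D A y + adj D A y'"] by (simp add: adj_cinner cinner_add_right)
  have scaleC: "c *\<^sub>C y \<in> adj_dom D A \<and> adj D A (c *\<^sub>C y) = c *\<^sub>C adj D A y"
    if "y \<in> adj_dom D A" for c y
    using that adj_eqI [of "c *\<^sub>C y" "c *\<^sub>C adj D A y"] by (simp add: adj_cinner cinner_scaleC_right)
  have "0 \<in> adj_dom D A"
    by (rule adj_domI [of 0 0]) simp
  with add scaleC show ?thesis
    unfolding clinear_on_def csubspace_def by blast
qed

lemma closed_op_graph_adj: "closed (op_graph (adj_dom D A) (adj D A))"
  unfolding closed_sequential_limits
proof (intro allI impI, elim conjE)
  fix p :: "nat \<Rightarrow> 'a \<times> 'b" and l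
  assume mem: "\<forall>n. p n \<in> op_graph (adj_dom D A) (adj D A)" and lim: "p \<longlonglongrightarrow> l"
  have dom: "snd (p n) \<in> adj_dom D A" and fst: "fst (p n) = adj D A (snd (p n))" for n
    using mem [rule_format, of n] by (auto simp: op_graph_def)
  have l: "cinner (A x) (snd l) = cinner x (fst l)" if "x \<in> D" for x
  proof (rule LIMSEQ_unique)
    show "(\<lambda>n. cinner (A x) (snd (p n))) \<longlonglongrightarrow> cinner (A x) (snd l)"
      using lim by (intro tendsto_cinner tendsto_const tendsto_snd)
    show "(\<lambda>n. cinner (A x) (snd (p n))) \<longlonglongrightarrow> cinner x (fst l)"
      using lim that by (simp add: adj_cinner [OF dom] flip: fst) (intro tendsto_cinner tendsto_const tendsto_fst)
  qed
  have "snd l \<in> adj_dom D A" "adj D A (snd l) = fst l"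
    using adj_domI [OF l] adj_eq [OF l] by blast+
  then show "l \<in> op_graph (adj_dom D A) (adj D A)"
    by (auto simp: op_graph_def intro: exI [of _ "snd l"] prod_eqI)
qed

lemma csubspace_op_graph_A: "csubspace (op_graph D A)"
  by (rule csubspace_op_graph [OF linear])

lemma closed_op_graph_A: "closed (op_graph D A)"
  using closed by (simp add: closed_op_def)

lemma orthogonal_op_graph_iff:
  "(\<forall>m\<in>op_graph D A. cinner r m = 0) \<longleftrightarrow> fst r \<in> adj_dom D A \<and> snd r = - adj D A (fst r)"
proof
  assume orth: "\<forall>m\<in>op_graph D A. cinner r m = 0"
  have "cinner (A x) (fst r) = cinner x (- snd r)" if "x \<in> D" for x
  proof -
    have "cinner (fst r) (A x) + cinner (snd r) x = 0"
      using orth that by (auto simp: op_graph_def cinner_prod_def)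
    then have "cinner (A x) (fst r) + cinner x (snd r) = 0"
      by (metis cinner_commute complex_cnj_add complex_cnj_zero)
    then show ?thesis
      by (simp add: cinner_minus_right eq_neg_iff_add_eq_0)
  qed
  then show "fst r \<in> adj_dom D A \<and> snd r = - adj D A (fst r)"
    using adj_eqI by fastforce
next
  assume "fst r \<in> adj_dom D A \<and> snd r = - adj D A (fst r)"
  then show "\<forall>m\<in>op_graph D A. cinner r m = 0"
    by (auto simp: op_graph_def cinner_prod_def cinner_minus_left adj_cinner
        cinner_commute [of "fst r"] cinner_commute [of "adj D A (fst r)"])
qed

text \<open>Projecting \<open>(k, h)\<close> onto the graph of \<open>A\<close> splits it as \<open>(A x, x) + (y, - A\<^sup>* y)\<close>.\<close>

lemma graph_decomposition:
  obtains x y where "x \<in> D" "y \<in> adj_dom D A" "k = A x + y" "h = x - adj D A y"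
proof -
  let ?G = "op_graph D A" and ?p = "proj (op_graph D A) (k, h)"
  obtain x where x: "x \<in> D" "?p = (A x, x)"
    using proj_in [OF csubspace_op_graph_A closed_op_graph_A] by (auto simp: op_graph_def)
  have "fst ((k, h) - ?p) \<in> adj_dom D A \<and> snd ((k, h) - ?p) = - adj D A (fst ((k, h) - ?p))"
    using proj_orthogonal [OF csubspace_op_graph_A closed_op_graph_A] orthogonal_op_graph_iff by blast
  with x show ?thesis
    using that [of x "k - A x"] by (simp add: algebra_simps)
qed

lemma check_op_unique_existence: "\<exists>!x. x \<in> D \<and> A x \<in> adj_dom D A \<and> x + adj D A (A x) = h"
proof -
  obtain x y where xy: "x \<in> D" "y \<in> adj_dom D A" "0 = A x + y" "h = x - adj D A y"
    by (rule graph_decomposition)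
  then have "y = - A x"
    by (simp add: eq_neg_iff_add_eq_0 add.commute)
  then have "A x \<in> adj_dom D A" "adj D A y = - adj D A (A x)"
    using xy(2) clinear_on_scaleC [OF clinear_on_adj, of "A x" "- 1"]
      csubspace_scaleC [OF clinear_on_csubspace [OF clinear_on_adj], of y "- 1"]
    by (simp_all flip: minus_eq_scaleC)
  then have "x \<in> D \<and> A x \<in> adj_dom D A \<and> x + adj D A (A x) = h"
    using xy by simp
  moreover have "x1 = x2"
    if "x1 \<in> D \<and> A x1 \<in> adj_dom D A \<and> x1 + adj D A (A x1) = h"
      and "x2 \<in> D \<and> A x2 \<in> adj_dom D A \<and> x2 + adj D A (A x2) = h" for x1 x2
  proof -
    let ?d = "x1 - x2"
    have "?d \<in> D" "A ?d \<in> adj_dom D A"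
      using that csubspace_D clinear_on_csubspace [OF clinear_on_adj]
      by (simp_all add: csubspace_diff A_diff)
    moreover have "?d + adj D A (A ?d) = 0"
      using that by (simp add: A_diff clinear_on_diff [OF clinear_on_adj] algebra_simps)
    ultimately have "?d = 0"
      using eq_0_if_add_eq_0_cinner_self [of ?d "adj D A (A ?d)" "A ?d"] adj_cinner by simp
    then show ?thesis
      by simp
  qed
  ultimately show ?thesis
    by blast
qed

lemma hat_op_unique_existence: "\<exists>!y. y \<in> adj_dom D A \<and> adj D A y \<in> D \<and> y + A (adj D A y) = k"
proof -
  obtain x y where xy: "x \<in> D" "y \<in> adj_dom D A" "k = A x + y" "0 = x - adj D A y"
    by (rule graph_decomposition)
  then have "y \<in> adj_dom D A \<and> adj D A y \<in> D \<and> y + A (adj D A y) = k"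
    by (simp add: add.commute)
  moreover have "y1 = y2"
    if "y1 \<in> adj_dom D A \<and> adj D A y1 \<in> D \<and> y1 + A (adj D A y1) = k"
      and "y2 \<in> adj_dom D A \<and> adj D A y2 \<in> D \<and> y2 + A (adj D A y2) = k" for y1 y2
  proof -
    let ?d = "y1 - y2"
    have d: "?d \<in> adj_dom D A" "adj D A ?d \<in> D"
      using that csubspace_D clinear_on_csubspace [OF clinear_on_adj]
      by (simp_all add: csubspace_diff clinear_on_diff [OF clinear_on_adj])
    have "?d + A (adj D A ?d) = 0"
      using that by (simp add: A_diff clinear_on_diff [OF clinear_on_adj] algebra_simps)
    moreover have "cinner ?d (A (adj D A ?d)) = cinner (adj D A ?d) (adj D A ?d)"
      using adj_cinner [OF d] by (metis cinner_commute)
    ultimately have "?d = 0"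
      by (rule eq_0_if_add_eq_0_cinner_self)
    then show ?thesis
      by simp
  qed
  ultimately show ?thesis
    by blast
qed

lemma
  shows check_op_in_domain: "check_op D A h \<in> D"
    and A_check_op_in_adj_dom: "A (check_op D A h) \<in> adj_dom D A"
    and check_op_eq: "check_op D A h + adj D A (A (check_op D A h)) = h"
  using theI' [OF check_op_unique_existence [of h]] unfolding check_op_def by auto

lemma
  shows hat_op_in_adj_dom: "hat_op D A k \<in> adj_dom D A"
    and adj_hat_op_in_domain: "adj D A (hat_op D A k) \<in> D"
    and hat_op_eq: "hat_op D A k + A (adj D A (hat_op D A k)) = k"
  using theI' [OF hat_op_unique_existence [of k]] unfolding hat_op_def by auto

lemma graph_resolvent_check_op: "graph_resolvent (check_op D A) D A"
proof
  show "cinner x h = cinner x (check_op D A h) + cinner (A x) (A (check_op D A h))" if "x \<in> D" for x h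
    using arg_cong [OF check_op_eq [of h], of "cinner x"] adj_cinner [OF A_check_op_in_adj_dom that]
    by (simp add: cinner_add_right)
  show "h = 0" if "check_op D A h = 0" for h
    using check_op_eq [of h] that by (simp add: A_0 adj_eq [of 0 0])
qed (simp_all add: linear closed_op_graph_A check_op_in_domain)

lemma graph_resolvent_hat_op: "graph_resolvent (hat_op D A) (adj_dom D A) (adj D A)"
proof
  show "cinner y k = cinner y (hat_op D A k) + cinner (adj D A y) (adj D A (hat_op D A k))"
    if "y \<in> adj_dom D A" for y k
    using arg_cong [OF hat_op_eq [of k], of "cinner y"] adj_cinner [OF that adj_hat_op_in_domain]
    by (simp add: cinner_add_right) (metis cinner_commute)
  show "k = 0" if "hat_op D A k = 0" for k
    using hat_op_eq [of k] that by (simp add: A_0 adj_eq [of 0 0])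
qed (simp_all add: clinear_on_adj closed_op_graph_adj hat_op_in_adj_dom)

end

section \<open>The gap between two operators with a common domain\<close>

lemma norm_divide_norm_le:
  fixes f :: "'a::real_normed_vector \<Rightarrow> 'b::real_normed_vector"
  shows "0 \<le> c \<Longrightarrow> norm (f x) \<le> c * norm x \<Longrightarrow> norm (f x) / norm x \<le> c"
  by (cases "x = 0") (auto simp: divide_le_eq mult.commute)

lemma ratio_le_opnorm_on:
  fixes f :: "'a::real_normed_vector \<Rightarrow> 'b::real_normed_vector"
  assumes bound: "\<And>x. x \<in> E \<Longrightarrow> norm (f x) \<le> K * norm x" and "x \<in> E"
  shows "norm (f x) / norm x \<le> opnorm_on E f"
proof -
  have "norm (f y) \<le> max K 0 * norm y" if "y \<in> E" for y
    using bound [OF that] by (smt (verit) mult_right_mono norm_ge_zero)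
  then show ?thesis
    unfolding opnorm_on_def using assms(2) norm_divide_norm_le [of "max K 0"]
    by (intro cSup_upper bdd_aboveI2 [of _ _ "max K 0"]) auto
qed

lemma norm_le_opnorm_on:
  fixes f :: "'a::real_normed_vector \<Rightarrow> 'b::real_normed_vector"
  assumes "f 0 = 0" "\<And>x. x \<in> E \<Longrightarrow> norm (f x) \<le> K * norm x" "x \<in> E"
  shows "norm (f x) \<le> opnorm_on E f * norm x"
  using ratio_le_opnorm_on [OF assms(2,3)] assms(1) by (cases "x = 0") (auto simp: divide_le_eq)

lemma opnorm_on_nonneg:
  fixes f :: "'a::real_normed_vector \<Rightarrow> 'b::real_normed_vector"
  assumes "0 \<in> E" "\<And>x. x \<in> E \<Longrightarrow> norm (f x) \<le> K * norm x"
  shows "0 \<le> opnorm_on E f"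
  using ratio_le_opnorm_on [OF assms(2,1)] by simp

lemma bounded_onI:
  fixes f :: "'a::real_normed_vector \<Rightarrow> 'b::real_normed_vector"
  assumes "f 0 = 0" "\<And>x. x \<in> E \<Longrightarrow> norm (f x) \<le> K * norm x"
  shows "bounded_on E f"
  unfolding bounded_on_def using norm_le_opnorm_on [OF assms] by blast

lemma opnorm_on_le:
  fixes f :: "'a::real_normed_vector \<Rightarrow> 'b::real_normed_vector"
  assumes "E \<noteq> {}" "0 \<le> c" "\<And>x. x \<in> E \<Longrightarrow> norm (f x) \<le> c * norm x"
  shows "opnorm_on E f \<le> c"
  unfolding opnorm_on_def using assms norm_divide_norm_le by (intro cSup_least) auto

lemma orth_proj_eq_proj: "orth_proj M z = proj M z"
  by (simp add: orth_proj_def proj_def prod_cinner_def cinner_prod_def)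

lemma norm_proj_diff_sq_split:
  fixes M N :: "'a::chilbert_space set"
  assumes M: "csubspace M" "closed M" and N: "csubspace N" "closed N"
  shows "(norm (proj M z - proj N z))\<^sup>2
    = (norm (proj M z - proj N (proj M z)))\<^sup>2 + (norm (proj N (z - proj M z)))\<^sup>2"
proof -
  have "proj N z = proj N (proj M z) + proj N (z - proj M z)"
    using linear_add [OF bounded_linear.linear [OF bounded_linear_proj [OF N]]] by (metis diff_add_cancel add.commute)
  moreover have "cinner (proj N (z - proj M z)) (proj M z - proj N (proj M z)) = 0"
    by (rule orthogonal_proj [OF N proj_in [OF N]])
  ultimately show ?thesis
    using norm_diff_sq_orthogonal [of "proj M z - proj N (proj M z)" "proj N (z - proj M z)"]
    by (simp add: diff_diff_eq cinner_commute [of "proj M z - _"])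
qed

text \<open>A bound on the distance from \<open>N\<close> to \<open>M\<close> bounds the projection onto \<open>N\<close> of \<open>M\<^sup>\<bottom>\<close>:
  \<open>\<parallel>P\<^sub>N n\<parallel>\<^sup>2 = \<langle>P\<^sub>N n - P\<^sub>M P\<^sub>N n, n\<rangle>\<close> for \<open>n \<perp> M\<close>.\<close>

lemma norm_proj_orthogonal_le:
  fixes M N :: "'a::chilbert_space set"
  assumes M: "csubspace M" "closed M" and N: "csubspace N" "closed N"
    and "0 \<le> \<beta>" and dist: "\<And>w. w \<in> N \<Longrightarrow> norm (w - proj M w) \<le> \<beta> * norm w"
  shows "norm (proj N (z - proj M z)) \<le> \<beta> * norm (z - proj M z)"
proof -
  let ?n = "z - proj M z"
  let ?w = "proj N ?n"
  have w: "?w \<in> N"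
    by (rule proj_in [OF N])
  have "cinner ?w ?w = cinner ?w ?n"
    using orthogonal_proj [OF N w, of ?n] by (simp add: cinner_diff_right)
  also have "\<dots> = cinner (?w - proj M ?w) ?n"
    using orthogonal_proj [OF M proj_in [OF M], of ?w z] by (simp add: cinner_diff_left)
  finally have "(norm ?w)\<^sup>2 \<le> norm (?w - proj M ?w) * norm ?n"
    using Re_cinner_le [of "?w - proj M ?w" ?n] by (simp flip: Re_cinner_self)
  also have "\<dots> \<le> \<beta> * norm ?w * norm ?n"
    using dist [OF w] by (intro mult_right_mono) auto
  finally have "norm ?w * norm ?w \<le> norm ?w * (\<beta> * norm ?n)"
    by (simp add: power2_eq_square algebra_simps)
  then show ?thesis
    using \<open>0 \<le> \<beta>\<close> by (cases "norm ?w = 0") (auto simp: mult_le_cancel_left_pos)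
qed

lemma gap_commute: "gap DA A DB B = gap DB B DA A"
  unfolding gap_def using onorm_neg [of "\<lambda>z. orth_proj (op_graph DB B) z - orth_proj (op_graph DA A) z"]
  by simp

locale operator_pair = S: closed_densely_defined D S + T: closed_densely_defined D T
  for D :: "'a::chilbert_space set" and S T :: "'a \<Rightarrow> 'b::chilbert_space"
begin

sublocale checkS: graph_resolvent "check_op D S" D S
  by (rule S.graph_resolvent_check_op)

sublocale hatT: graph_resolvent "hat_op D T" "adj_dom D T" "adj D T"
  by (rule T.graph_resolvent_hat_op)

abbreviation F :: "'a \<Rightarrow> 'b" where
  "F \<equiv> \<lambda>u. op_sqrt (hat_op D T) (T (op_sqrt (check_op D S) u) - S (op_sqrt (check_op D S) u))"

abbreviation G :: "'a \<Rightarrow> 'b" where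
  "G \<equiv> \<lambda>u. op_sqrt (hat_op D S) (S (op_sqrt (check_op D T) u) - T (op_sqrt (check_op D T) u))"

text \<open>With \<open>R = checkS.R\<close> and \<open>Q = hatT.R\<close>, the maps \<open>u \<mapsto> (S (R u), R u)\<close> and
  \<open>u' \<mapsto> (Q u', - T\<^sup>* (Q u'))\<close> parametrise isometrically the graph of \<open>S\<close> and the orthogonal
  complement of the graph of \<open>T\<close>; in these coordinates their inner product is \<open>- \<langle>F u, u'\<rangle>\<close>.\<close>

lemma cinner_graph_S_perp_graph_T:
  "cinner (S (checkS.R u), checkS.R u) (hatT.R u', - adj D T (hatT.R u')) = - cinner (F u) u'"
proof -
  let ?x = "checkS.R u" and ?y = "hatT.R u'"
  have "cinner (S ?x, ?x) (?y, - adj D T ?y) = cinner (S ?x) ?y - cinner ?x (adj D T ?y)"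
    by (simp add: cinner_Pair cinner_minus_right)
  also have "\<dots> = cinner (S ?x - T ?x) ?y"
    using T.adj_cinner [OF hatT.R_in_domain checkS.R_in_domain] by (simp add: cinner_diff_left)
  also have "\<dots> = - cinner (T ?x - S ?x) ?y"
    by (metis cinner_minus_left minus_diff_eq)
  also have "\<dots> = - cinner (F u) u'"
    by (simp add: hatT.R_selfadjoint)
  finally show ?thesis .
qed

lemma norm_graph_S_point: "norm (S (checkS.R u), checkS.R u) = norm u"
  using checkS.norm_graph_R_sq [of u] by (simp add: norm_prod_def add.commute)

lemma graph_S_parametrization:
  assumes "w \<in> op_graph D S"
  obtains u where "w = (S (checkS.R u), checkS.R u)"
proof -
  obtain x where "x \<in> D" "w = (S x, x)"
    using assms by (auto simp: op_graph_def)
  then show ?thesis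
    using checkS.R_surjective that by metis
qed

lemma perp_graph_T_point: "\<forall>m\<in>op_graph D T. cinner (hatT.R u', - adj D T (hatT.R u')) m = 0"
  using T.orthogonal_op_graph_iff hatT.R_in_domain by simp

lemma norm_perp_graph_T_point: "norm (hatT.R u', - adj D T (hatT.R u')) = norm u'"
  using hatT.norm_graph_R_sq [of u'] by (simp add: norm_prod_def)

lemma perp_graph_T_parametrization:
  assumes "\<forall>m\<in>op_graph D T. cinner r m = 0"
  obtains u' where "r = (hatT.R u', - adj D T (hatT.R u'))"
proof -
  have r: "fst r \<in> adj_dom D T" "snd r = - adj D T (fst r)"
    using T.orthogonal_op_graph_iff assms by blast+
  then show ?thesis
    using hatT.R_surjective [OF r(1)] that by (metis prod.collapse)
qed

lemma dist_graph_T_le: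
  assumes "0 \<le> \<alpha>" and F: "\<And>u. norm (F u) \<le> \<alpha> * norm u" and w: "w \<in> op_graph D S"
  shows "norm (w - proj (op_graph D T) w) \<le> \<alpha> * norm w"
proof -
  note GT = T.csubspace_op_graph_A T.closed_op_graph_A
  let ?r = "w - proj (op_graph D T) w"
  obtain u where u: "w = (S (checkS.R u), checkS.R u)"
    using graph_S_parametrization [OF w] .
  obtain u' where u': "?r = (hatT.R u', - adj D T (hatT.R u'))"
    using perp_graph_T_parametrization [OF proj_orthogonal [OF GT]] .
  have "cinner ?r ?r = cinner w ?r"
    using orthogonal_proj [OF GT proj_in [OF GT], of w] by (simp add: cinner_diff_left)
  also have "\<dots> = cinner w (hatT.R u', - adj D T (hatT.R u'))"
    by (simp only: u')
  also have "\<dots> = - cinner (F u) u'"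
    unfolding u by (rule cinner_graph_S_perp_graph_T)
  finally have "(norm ?r)\<^sup>2 \<le> norm (F u) * norm u'"
    using Re_cinner_le [of "- F u" u'] by (simp add: cinner_minus_left flip: Re_cinner_self)
  also have "\<dots> \<le> \<alpha> * norm w * norm ?r"
  proof -
    have "norm u' = norm ?r"
      by (simp only: u' norm_perp_graph_T_point)
    moreover have "norm u = norm w"
      by (simp only: u norm_graph_S_point)
    ultimately show ?thesis
      using F [of u] by (simp add: mult_right_mono)
  qed
  finally have "norm ?r * norm ?r \<le> norm ?r * (\<alpha> * norm w)"
    by (simp add: power2_eq_square algebra_simps)
  then show ?thesis
    using \<open>0 \<le> \<alpha>\<close> by (cases "norm ?r = 0") (auto simp: mult_le_cancel_left_pos)
qed

lemma norm_F_le_dist_graph_T: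
  "norm (F u) \<le> norm ((S (checkS.R u), checkS.R u) - proj (op_graph D T) (S (checkS.R u), checkS.R u))"
proof -
  note GT = T.csubspace_op_graph_A T.closed_op_graph_A
  let ?w = "(S (checkS.R u), checkS.R u)" and ?n = "(hatT.R (F u), - adj D T (hatT.R (F u)))"
  have "cinner (F u) (F u) = - cinner ?w ?n"
    using cinner_graph_S_perp_graph_T [of u "F u"] by simp
  also have "\<dots> = - cinner (?w - proj (op_graph D T) ?w) ?n"
    using perp_graph_T_point [of "F u"] proj_in [OF GT, of ?w]
    by (simp add: cinner_diff_left cinner_commute [of "proj _ _"])
  finally have "(norm (F u))\<^sup>2 = Re (- cinner (?w - proj (op_graph D T) ?w) ?n)"
    by (simp flip: Re_cinner_self)
  also have "\<dots> \<le> norm (?w - proj (op_graph D T) ?w) * norm (F u)"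
    using complex_Re_le_cmod [of "- cinner (?w - proj (op_graph D T) ?w) ?n"]
      norm_cinner_le [of "?w - proj (op_graph D T) ?w" ?n]
    by (simp add: norm_perp_graph_T_point)
  finally have "(norm (F u))\<^sup>2 \<le> norm (?w - proj (op_graph D T) ?w) * norm (F u)" .
  then show ?thesis
    by (cases "norm (F u) = 0") (auto simp: power2_eq_square mult_le_cancel_right_pos)
qed

lemma norm_F_le: "norm (F u) \<le> norm u"
  using norm_F_le_dist_graph_T [of u]
    norm_diff_proj_le [OF T.csubspace_op_graph_A T.closed_op_graph_A, of "(S (checkS.R u), checkS.R u)"]
  by (simp add: norm_graph_S_point)

lemma F_0: "F 0 = 0"
  by (simp add: checkS.R_0 S.A_0 T.A_0 hatT.R_0)

lemma bounded_on_F: "bounded_on UNIV F"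
  using norm_F_le by (intro bounded_onI [of _ _ 1]) (simp_all add: F_0)

lemma opnorm_F_le_gap: "opnorm_on UNIV F \<le> gap D S D T"
proof (rule opnorm_on_le)
  note GS = S.csubspace_op_graph_A S.closed_op_graph_A and GT = T.csubspace_op_graph_A T.closed_op_graph_A
  have bl: "bounded_linear (\<lambda>z. proj (op_graph D S) z - proj (op_graph D T) z)"
    by (intro bounded_linear_sub bounded_linear_proj GS GT)
  then show "0 \<le> gap D S D T"
    unfolding gap_def orth_proj_eq_proj by (rule onorm_pos_le)
  fix u
  let ?w = "(S (checkS.R u), checkS.R u)"
  have "?w \<in> op_graph D S"
    using checkS.R_in_domain by (auto simp: op_graph_def)
  then have "norm (F u) \<le> norm (proj (op_graph D S) ?w - proj (op_graph D T) ?w)"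
    using norm_F_le_dist_graph_T [of u] by (simp add: proj_id [OF GS])
  also have "\<dots> \<le> gap D S D T * norm u"
    using onorm [OF bl, of ?w] by (simp add: gap_def orth_proj_eq_proj norm_graph_S_point)
  finally show "norm (F u) \<le> gap D S D T * norm u" .
qed simp

lemma opnorm_F_le_opnorm_diff:
  assumes "bounded_on D (\<lambda>x. S x - T x)"
  shows "opnorm_on UNIV F \<le> opnorm_on D (\<lambda>x. S x - T x)"
proof -
  obtain C where C: "\<And>x. x \<in> D \<Longrightarrow> norm (S x - T x) \<le> C * norm x"
    using assms unfolding bounded_on_def by blast
  have 0: "0 \<in> D" and f0: "S 0 - T 0 = 0"
    by (simp_all add: csubspace_0 [OF S.csubspace_D] S.A_0 T.A_0)
  have M1: "0 \<le> opnorm_on D (\<lambda>x. S x - T x)"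
    by (rule opnorm_on_nonneg [where K = C]) (simp_all add: 0 C)
  have M2: "norm (S x - T x) \<le> opnorm_on D (\<lambda>x. S x - T x) * norm x" if "x \<in> D" for x
    by (rule norm_le_opnorm_on [where K = C]) (simp_all add: f0 C that)
  show ?thesis
  proof (rule opnorm_on_le)
    show "0 \<le> opnorm_on D (\<lambda>x. S x - T x)"
      by (rule M1)
    fix u
    have "norm (F u) \<le> norm (S (checkS.R u) - T (checkS.R u))"
      using hatT.norm_R_le [of "T (checkS.R u) - S (checkS.R u)"] by (simp add: norm_minus_commute)
    also have "\<dots> \<le> opnorm_on D (\<lambda>x. S x - T x) * norm (checkS.R u)"
      by (rule M2 [OF checkS.R_in_domain])
    also have "\<dots> \<le> opnorm_on D (\<lambda>x. S x - T x) * norm u"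
      using M1 checkS.norm_R_le by (simp add: mult_left_mono)
    finally show "norm (F u) \<le> opnorm_on D (\<lambda>x. S x - T x) * norm u" .
  qed simp
qed

lemma operator_pair_swap: "operator_pair D T S"
  by (rule operator_pair.intro [OF T.closed_densely_defined_axioms S.closed_densely_defined_axioms])

text \<open>Splitting \<open>P\<^sub>S z - P\<^sub>T z\<close> along \<open>z = P\<^sub>S z + (z - P\<^sub>S z)\<close>, the first part is a point of
  the graph of \<open>S\<close> minus its projection to the graph of \<open>T\<close>, and the second is controlled by
  the same estimate for the pair \<open>(T, S)\<close>.\<close>

lemma gap_le_max_opnorm: "gap D S D T \<le> max (opnorm_on UNIV F) (opnorm_on UNIV G)"
proof -
  interpret TS: operator_pair D T S
    by (rule operator_pair_swap)
  note GS = S.csubspace_op_graph_A S.closed_op_graph_A and GT = T.csubspace_op_graph_A T.closed_op_graph_A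
  let ?P = "proj (op_graph D S)" and ?Q = "proj (op_graph D T)"
  let ?a = "opnorm_on UNIV F" and ?b = "opnorm_on UNIV G" and ?m = "max (opnorm_on UNIV F) (opnorm_on UNIV G)"
  have a: "0 \<le> ?a" "norm (F u) \<le> ?a * norm u" for u
    using norm_F_le by (auto intro: opnorm_on_nonneg [where K = 1] norm_le_opnorm_on [where K = 1] simp: F_0)
  have b: "0 \<le> ?b" "norm (G u) \<le> ?b * norm u" for u
    using TS.norm_F_le by (auto intro: opnorm_on_nonneg [where K = 1] norm_le_opnorm_on [where K = 1] simp: TS.F_0)
  show ?thesis
    unfolding gap_def orth_proj_eq_proj
  proof (rule onorm_bound)
    show "0 \<le> ?m"
      using a(1) by simp
    fix z
    have "(norm (?P z - ?Q z))\<^sup>2 = (norm (?P z - ?Q (?P z)))\<^sup>2 + (norm (?Q (z - ?P z)))\<^sup>2"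
      by (rule norm_proj_diff_sq_split [OF GS GT])
    also have "\<dots> \<le> (?a * norm (?P z))\<^sup>2 + (?b * norm (z - ?P z))\<^sup>2"
      using dist_graph_T_le [OF a] proj_in [OF GS, of z]
        norm_proj_orthogonal_le [OF GS GT b(1) TS.dist_graph_T_le [OF b]]
      by (intro add_mono power_mono) auto
    also have "\<dots> \<le> ?m\<^sup>2 * ((norm (?P z))\<^sup>2 + (norm (z - ?P z))\<^sup>2)"
    proof -
      have "?a\<^sup>2 \<le> ?m\<^sup>2" "?b\<^sup>2 \<le> ?m\<^sup>2"
        using a(1) b(1) by (simp_all add: power_mono)
      then show ?thesis
        by (simp add: power_mult_distrib distrib_left add_mono mult_right_mono)
    qed
    also have "\<dots> = (?m * norm z)\<^sup>2"
      by (simp add: power_mult_distrib flip: norm_proj_sq [OF GS])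
    finally show "norm (?P z - ?Q z) \<le> ?m * norm z"
      by (rule power2_le_imp_le) (use a(1) in simp)
  qed
qed

lemma gap_eq_max_opnorm: "gap D S D T = max (opnorm_on UNIV F) (opnorm_on UNIV G)"
proof -
  interpret TS: operator_pair D T S
    by (rule operator_pair_swap)
  show ?thesis
    using gap_le_max_opnorm opnorm_F_le_gap TS.opnorm_F_le_gap gap_commute [of D T D S] by simp
qed

lemma bounded_on_G: "bounded_on UNIV G"
  using operator_pair.bounded_on_F [OF operator_pair_swap] .

lemma gap_le_opnorm_diff:
  assumes "bounded_on D (\<lambda>x. T x - S x)"
  shows "gap D S D T \<le> opnorm_on D (\<lambda>x. S x - T x)"
proof -
  have "bounded_on D (\<lambda>x. S x - T x)"
    using assms by (simp add: bounded_on_def norm_minus_commute)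
  then show ?thesis
    using opnorm_F_le_opnorm_diff operator_pair.opnorm_F_le_opnorm_diff [OF operator_pair_swap] assms
    by (simp add: gap_eq_max_opnorm opnorm_on_def norm_minus_commute)
qed

end

theorem theorem3p1:
  fixes D :: "'a::chilbert_space set"
    and S T :: "'a \<Rightarrow> 'b::chilbert_space"
  assumes inf1: "infinite_dimensional TYPE('a)"
    and inf2: "infinite_dimensional TYPE('b)"
    and linS: "clinear_on D S" and linT: "clinear_on D T"
    and dense: "densely_defined D"
    and closedS: "closed_op D S" and closedT: "closed_op D T"
  shows
    "(let ES = {x. op_sqrt (check_op D S) x \<in> D};
          ET = {x. op_sqrt (check_op D T) x \<in> D};
          F = (\<lambda>x. op_sqrt (hat_op D T)
                  (T (op_sqrt (check_op D S) x) - S (op_sqrt (check_op D S) x)));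
          G = (\<lambda>x. op_sqrt (hat_op D S)
                  (S (op_sqrt (check_op D T) x) - T (op_sqrt (check_op D T) x)))
      in bounded_on ES F \<and> bounded_on ET G \<and>
         gap D S D T = max (opnorm_on ES F) (opnorm_on ET G))
     \<and> (bounded_on D (\<lambda>x. T x - S x) \<longrightarrow> gap D S D T \<le> opnorm_on D (\<lambda>x. S x - T x))"
proof -
  interpret operator_pair D S T
    using linS linT dense closedS closedT by (simp add: operator_pair_def closed_densely_defined_def)
  have "{x. op_sqrt (check_op D S) x \<in> D} = UNIV" "{x. op_sqrt (check_op D T) x \<in> D} = UNIV"
    using checkS.R_in_domain graph_resolvent.R_in_domain [OF T.graph_resolvent_check_op] by auto
  then show ?thesis
    using bounded_on_F bounded_on_G gap_eq_max_opnorm gap_le_opnorm_diff by (simp add: Let_def)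
qed

end
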